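(* For every integer $m\ge 2$, $\pi_f(K_{m+1,m,m})=\frac{6m}{2m+1}$.
   Context: $K_{a,b,c}$ is the complete tripartite graph with parts of sizes $a,b,c$. Two edges are nonincident if they share no endpoint. A linear ordering of $V(G)$ separates a pair of nonincident edges if both endpoints of one edge precede both endpoints of the other. $\pi_t(G)$ is the minimum length of a list of linear orderings of $V(G)$ (repetitions allowed) separating every pair of nonincident edges at least $t$ times, and the fractional separation dimension is $\pi_f(G)=\liminf_{t\to\infty}\pi_t(G)/t$. *)

theory Defs
  imports "HOL-Library.Extended_Real"
begin

record 'v graph =
  vertices :: "'v set"
  edges :: "'v set set"

text \<open>Vertex \<open>(i, j)\<close> is the \<open>j\<close>-th vertex of the \<open>i\<close>-th part.\<close>

definition complete_tripartite :: "nat \<Rightarrow> nat \<Rightarrow> nat \<Rightarrow> (nat \<times> nat) graph" where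
  "complete_tripartite a b c =
    (let V = {0} \<times> {..<a} \<union> {1} \<times> {..<b} \<union> {2} \<times> {..<c}
     in \<lparr>vertices = V, edges = {{u, v} | u v. u \<in> V \<and> v \<in> V \<and> fst u \<noteq> fst v}\<rparr>)"

definition nonincident :: "'v set \<Rightarrow> 'v set \<Rightarrow> bool" where
  "nonincident e f \<longleftrightarrow> e \<inter> f = {}"

definition all_precede :: "'v rel \<Rightarrow> 'v set \<Rightarrow> 'v set \<Rightarrow> bool" where
  "all_precede r e f \<longleftrightarrow> (\<forall>x\<in>e. \<forall>y\<in>f. (x, y) \<in> r \<and> x \<noteq> y)"

definition separates :: "'v rel \<Rightarrow> 'v set \<Rightarrow> 'v set \<Rightarrow> bool" where
  "separates r e f \<longleftrightarrow> all_precede r e f \<or> all_precede r f e"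

definition separating_list :: "'v graph \<Rightarrow> nat \<Rightarrow> 'v rel list \<Rightarrow> bool" where
  "separating_list G t L \<longleftrightarrow>
    (\<forall>r\<in>set L. linear_order_on (vertices G) r) \<and>
    (\<forall>e\<in>edges G. \<forall>f\<in>edges G. nonincident e f \<longrightarrow>
      t \<le> card {i. i < length L \<and> separates (L ! i) e f})"

definition sep_dim :: "nat \<Rightarrow> 'v graph \<Rightarrow> nat" where
  "sep_dim t G = (LEAST k. \<exists>L. length L = k \<and> separating_list G t L)"

definition frac_sep_dim :: "'v graph \<Rightarrow> ereal" where
  "frac_sep_dim G = liminf (\<lambda>t. ereal (real (sep_dim t G) / real t))"

end

theory Submission
  imports Defs "HOL-Combinatorics.Permutations"
begin

text \<open>
  Let \<open>A\<close>, \<open>B\<close>, \<open>C\<close> be the parts, of sizes \<open>m + 1\<close>, \<open>m\<close>, \<open>m\<close>. An order of the vertices separates exactly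
  one of the three ways to split four vertices into two pairs. Hence the number of separated pairs
  \<open>{x, y}\<close>, \<open>{x', z}\<close> with \<open>x\<close>, \<open>x'\<close> in a part \<open>X\<close> of size \<open>n\<close> and fixed \<open>y\<close>, \<open>z\<close> outside \<open>X\<close> is
  \<open>(n - 1) max(a, b) - a(a - 1)/2 - b(b - 1)/2\<close>, where \<open>a\<close> and \<open>b\<close> vertices of \<open>X\<close> precede \<open>y\<close> and \<open>z\<close>.

  Lower bound: give equal weight to all pairs whose four endpoints meet all three parts. Summing the
  formula over them, an order is charged one term for each vertex of \<open>A\<close> and one for each vertex of \<open>C\<close>,
  and each term can be optimised separately; no order separates more than a fraction
  \<open>(2m + 1)/(6m)\<close> of the pairs.

  Upper bound: the optimum is attained by \<open>A B C A B C \<dots> A B C A\<close>. Averaging this order and the one with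
  \<open>B\<close> and \<open>C\<close> exchanged over all permutations preserving the parts separates every pair of nonincident
  edges with frequency at least \<open>(2m + 1)/(6m)\<close>.
\<close>

section \<open>Counting separated pairs\<close>

definition cnt :: "('v \<Rightarrow> nat) \<Rightarrow> 'v set \<Rightarrow> 'v \<Rightarrow> nat" where
  "cnt p X v = card {x \<in> X. p x < p v}"

definition rank_sep :: "('v \<Rightarrow> nat) \<Rightarrow> 'v \<Rightarrow> 'v \<Rightarrow> 'v \<Rightarrow> 'v \<Rightarrow> bool" where
  "rank_sep p u v u' v' \<longleftrightarrow> max (p u) (p v) < min (p u') (p v') \<or> max (p u') (p v') < min (p u) (p v)"

text \<open>For two disjoint parts this is the full product; for one part taken twice it drops the
  equal pairs. One notion thus serves edge pairs meeting two parts and edge pairs meeting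
  three.\<close>

definition offdiag :: "'v set \<Rightarrow> 'v set \<Rightarrow> ('v \<times> 'v) set" where
  "offdiag X Y = {(x, y). x \<in> X \<and> y \<in> Y \<and> x \<noteq> y}"

lemma finite_offdiag [simp]: "finite X \<Longrightarrow> finite Y \<Longrightarrow> finite (offdiag X Y)"
  unfolding offdiag_def by (rule finite_subset[of _ "X \<times> Y"]) auto

lemma card_offdiag:
  assumes "finite X"
  shows "real (card (offdiag X X)) = real (card X) * (real (card X) - 1)"
proof -
  have "offdiag X X = X \<times> X - (\<lambda>x. (x, x)) ` X" by (auto simp: offdiag_def)
  moreover have "card ((\<lambda>x. (x, x)) ` X) = card X" by (intro card_image) (auto simp: inj_on_def)
  ultimately have "card (offdiag X X) = card X * card X - card X"
    using assms by (subst \<open>offdiag X X = _\<close>, subst card_Diff_subset) (auto simp: card_cartesian_product)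
  then show ?thesis
    by (cases "card X") (simp_all add: algebra_simps)
qed

text \<open>Along \<open>p\<close> the number of predecessors inside \<open>X\<close> strictly
  increases and stays below \<open>card X\<close>. A sum over \<open>X\<close> of a function of each
  vertex's own rank therefore becomes a sum over an initial segment of the naturals.\<close>

lemma bij_betw_cnt:
  assumes "finite X" "inj_on p X"
  shows "bij_betw (cnt p X) X {..<card X}"
proof -
  have less: "cnt p X x < cnt p X y" if "x \<in> X" "p x < p y" for x y
    unfolding cnt_def using assms that by (intro psubset_card_mono) auto
  have inj: "inj_on (cnt p X) X"
    by (rule inj_onI) (metis assms(2) inj_on_def less less_irrefl linorder_neqE_nat)
  have "cnt p X x < card X" if "x \<in> X" for x
    unfolding cnt_def using assms(1) that by (intro psubset_card_mono) auto
  then have "cnt p X ` X \<subseteq> {..<card X}" by auto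
  then have "cnt p X ` X = {..<card X}"
    by (intro card_subset_eq) (auto simp: card_image[OF inj])
  with inj show ?thesis by (simp add: bij_betw_def)
qed

lemma sum_cnt:
  assumes "finite X" "inj_on p X"
  shows "(\<Sum>x\<in>X. g (cnt p X x)) = (\<Sum>i<card X. g i)"
  using sum.reindex_bij_betw[OF bij_betw_cnt[OF assms], of g] by simp

text \<open>The vertices of \<open>X\<close> before \<open>y\<close> and those before
  \<open>z\<close> form nested sets, so the larger count is that of the union.\<close>

lemma max_cnt:
  assumes "finite X"
  shows "max (cnt p X y) (cnt p X z) = card {x \<in> X. p x < p y \<or> p x < p z}"
proof -
  have mono: "cnt p X u \<le> cnt p X v" if "p u \<le> p v" for u v
    unfolding cnt_def using assms that by (intro card_mono) auto
  show ?thesis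
  proof (cases "p y \<le> p z")
    case True
    then have "{x \<in> X. p x < p y \<or> p x < p z} = {x \<in> X. p x < p z}" by auto
    with mono[OF True] show ?thesis by (simp add: cnt_def)
  next
    case False
    then have "{x \<in> X. p x < p y \<or> p x < p z} = {x \<in> X. p x < p y}" by auto
    with mono[of z y] False show ?thesis by (simp add: cnt_def)
  qed
qed

text \<open>If \<open>p y \<le> p z\<close>, then \<open>x\<close> and \<open>x'\<close> lie both
  before \<open>y\<close> or both after \<open>z\<close>, which gives
  \<open>cy * (cy - 1) + (n - cz) * (n - cz - 1)\<close> ordered pairs. As \<open>cz\<close> is then
  the maximum, expanding yields the stated form, symmetric in \<open>y\<close> and
  \<open>z\<close>.\<close>

lemma count_same_side:
  assumes X: "finite X" and y: "p y \<notin> p ` X" and z: "p z \<notin> p ` X"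
  defines "n \<equiv> real (card X)" and "cy \<equiv> real (cnt p X y)" and "cz \<equiv> real (cnt p X z)"
  shows "(\<Sum>(x, x')\<in>offdiag X X. of_bool (rank_sep p x x' y z)) =
    cy * (cy - 1) + cz * (cz - 1) + n * (n - 1) - 2 * (n - 1) * max cy cz"
  using y z unfolding cy_def cz_def
proof (induction "p y" "p z" arbitrary: y z rule: linorder_wlog)
  case (le y z)
  let ?L = "{x \<in> X. p x < p y}" and ?R = "{x \<in> X. p z < p x}"
  have "p x \<noteq> p z" if "x \<in> X" for x using le(3) that by (metis imageI)
  then have R: "?R = X - {x \<in> X. p x < p z}" by (auto simp: not_less order.strict_iff_order)
  have cL: "card ?L = cnt p X y" by (simp add: cnt_def)
  have cR: "real (card ?R) = n - real (cnt p X z)"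
    unfolding R using X by (subst card_Diff_subset) (auto simp: cnt_def n_def intro!: of_nat_diff card_mono)
  have "{q \<in> offdiag X X. (\<lambda>(x, x'). rank_sep p x x' y z) q} = offdiag ?L ?L \<union> offdiag ?R ?R"
    using le by (auto simp: offdiag_def rank_sep_def)
  moreover have "offdiag ?L ?L \<inter> offdiag ?R ?R = {}"
    using le by (auto simp: offdiag_def)
  ultimately have "real (card {q \<in> offdiag X X. (\<lambda>(x, x'). rank_sep p x x' y z) q})
      = real (card (offdiag ?L ?L)) + real (card (offdiag ?R ?R))"
    using X by (simp add: card_Un_disjoint)
  moreover have "(\<Sum>(x, x')\<in>offdiag X X. of_bool (rank_sep p x x' y z)) = 
     real (card {q \<in> offdiag X X. (\<lambda>(x, x'). rank_sep p x x' y z) q})"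
    using X by (simp add: split_def Int_def)
  moreover have "cnt p X y \<le> cnt p X z"
    unfolding cnt_def using X le by (intro card_mono) auto
  ultimately show ?case
    using X by (simp add: card_offdiag cR cL max_absorb2) (simp add: algebra_simps)
next
  case (sym y z)
  have "rank_sep p x x' y z = rank_sep p x x' z y" for x x'
    by (auto simp: rank_sep_def)
  then show ?case
    using sym(1)[OF refl refl sym(3) sym(2)] by (simp only: max.commute add.commute)
qed

lemma sum_offdiag_swap:
  "(\<Sum>(x, x')\<in>offdiag X X. g x x') = (\<Sum>(x, x')\<in>offdiag X X. g x' x)"
  by (rule sum.reindex_bij_witness[of _ prod.swap prod.swap]) (auto simp: offdiag_def)

text \<open>Of the three ways to split \<open>x, x', y, z\<close> into two pairs, every order separates exactly one.\<close>

lemma count_separated: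
  assumes X: "finite X" "inj_on p X" and y: "p y \<notin> p ` X" and z: "p z \<notin> p ` X" and "p y \<noteq> p z"
  defines "n \<equiv> real (card X)" and "cy \<equiv> real (cnt p X y)" and "cz \<equiv> real (cnt p X z)"
  shows "2 * (\<Sum>(x, x')\<in>offdiag X X. of_bool (rank_sep p x y x' z)) =
    2 * (n - 1) * max cy cz - cy * (cy - 1) - cz * (cz - 1)"
proof -
  let ?S = "\<Sum>(x, x')\<in>offdiag X X. of_bool (rank_sep p x y x' z) :: real"
  have one: "of_bool (rank_sep p x y x' z) + of_bool (rank_sep p x' y x z) + of_bool (rank_sep p x x' y z) = (1::real)"
    if "(x, x') \<in> offdiag X X" for x x'
  proof -
    have x: "x \<in> X" "x' \<in> X" "x \<noteq> x'" using that by (auto simp: offdiag_def)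
    have "p x \<noteq> p x'" "p x \<noteq> p y" "p x \<noteq> p z" "p x' \<noteq> p y" "p x' \<noteq> p z"
      using x inj_onD[OF X(2)] y z by (metis imageI)+
    then have "p x < p x' \<or> p x' < p x" "p x < p y \<or> p y < p x" "p x < p z \<or> p z < p x"
      "p x' < p y \<or> p y < p x'" "p x' < p z \<or> p z < p x'" "p y < p z \<or> p z < p y"
      using \<open>p y \<noteq> p z\<close> by (simp_all only: neq_iff)
    then show ?thesis
      by (elim disjE) (simp_all add: rank_sep_def less_not_sym)
  qed
  let ?U = "\<Sum>(x, x')\<in>offdiag X X. of_bool (rank_sep p x x' y z) :: real"
  \<comment> \<open>Exchanging \<open>x\<close> and \<open>x'\<close> turns the split xy|x'z into
    x'y|xz, so these two splits have the same total. Twice \<open>?S\<close> plus \<open>?U\<close>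
    is therefore the number of all ordered pairs.\<close>
  have "?S + ?S + ?U = ?S + (\<Sum>(x, x')\<in>offdiag X X. of_bool (rank_sep p x' y x z)) + ?U"
    by (rule arg_cong[where f = "\<lambda>s. ?S + s + ?U", OF sum_offdiag_swap])
  also have "\<dots> = (\<Sum>q\<in>offdiag X X. 1)"
    unfolding sum.distrib[symmetric] by (rule sum.cong[OF refl]) (use one in auto)
  also have "\<dots> = n * (n - 1)" using card_offdiag[OF X(1)] by (simp add: n_def)
  finally show ?thesis
    unfolding count_same_side[OF X(1) y z] n_def cy_def cz_def by simp
qed

text \<open>The separated edge pairs \<open>{x, y}\<close>, \<open>{x', z}\<close> sharing the part
  \<open>X\<close>. Each pair is counted once for disjoint \<open>Y\<close> and \<open>Z\<close>,
  and twice for \<open>Y = Z\<close>, uniformly over all pairs of a type.\<close>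

definition sepsum :: "('v \<Rightarrow> nat) \<Rightarrow> 'v set \<Rightarrow> 'v set \<Rightarrow> 'v set \<Rightarrow> real" where
  "sepsum p X Y Z =
    (\<Sum>(y, z)\<in>offdiag Y Z. \<Sum>(x, x')\<in>offdiag X X. of_bool (rank_sep p x y x' z))"

lemma sepsum_eq:
  assumes fin: "finite X" and inj: "inj_on p (X \<union> Y \<union> Z)" and disj: "X \<inter> Y = {}" "X \<inter> Z = {}"
  shows "2 * sepsum p X Y Z = (\<Sum>(y, z)\<in>offdiag Y Z.
    2 * (real (card X) - 1) * max (real (cnt p X y)) (real (cnt p X z))
      - real (cnt p X y) * (real (cnt p X y) - 1) - real (cnt p X z) * (real (cnt p X z) - 1))"
proof -
  have "2 * (\<Sum>(x, x')\<in>offdiag X X. of_bool (rank_sep p x y x' z)) =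
    2 * (real (card X) - 1) * max (real (cnt p X y)) (real (cnt p X z))
      - real (cnt p X y) * (real (cnt p X y) - 1) - real (cnt p X z) * (real (cnt p X z) - 1)"
    if "(y, z) \<in> offdiag Y Z" for y z
  proof (rule count_separated[OF fin])
    show "inj_on p X" using inj by (rule inj_on_subset) auto
    have yz: "y \<in> Y" "z \<in> Z" "y \<noteq> z" using that by (auto simp: offdiag_def)
    have neq: "p u \<noteq> p v" if "u \<in> X \<union> Y \<union> Z" "v \<in> X \<union> Y \<union> Z" "u \<noteq> v" for u v
      using inj_onD[OF inj] that by blast
    show "p y \<noteq> p z" using yz by (intro neq) auto
    show "p y \<notin> p ` X"
    proof
      assume "p y \<in> p ` X"
      then obtain x where "x \<in> X" "p y = p x" by blast
      then show False using neq[of y x] yz disj by blast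
    qed
    show "p z \<notin> p ` X"
    proof
      assume "p z \<in> p ` X"
      then obtain x where "x \<in> X" "p z = p x" by blast
      then show False using neq[of z x] yz disj by blast
    qed
  qed
  then show ?thesis
    unfolding sepsum_def by (subst sum_distrib_left, intro sum.cong refl) (simp only: split: prod.splits, blast)
qed

lemma real_cnt_eq_sum: "finite X \<Longrightarrow> real (cnt p X v) = (\<Sum>x\<in>X. of_bool (p x < p v))"
  by (simp only: cnt_def sum_of_bool_eq Int_def mem_Collect_eq)

section \<open>The weighted bound for a single order\<close>

text \<open>The number of triples with one vertex from each of \<open>X\<close>, \<open>Y\<close>,
  \<open>Z\<close> in which the vertex of \<open>X\<close> comes last.\<close>

definition last_triples :: "('v \<Rightarrow> nat) \<Rightarrow> 'v set \<Rightarrow> 'v set \<Rightarrow> 'v set \<Rightarrow> real" where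
  "last_triples p X Y Z = (\<Sum>x\<in>X. real (cnt p Y x) * real (cnt p Z x))"

lemma last_triples_eq_sum:
  assumes "finite Y" "finite Z"
  shows "last_triples p X Y Z = (\<Sum>x\<in>X. \<Sum>y\<in>Y. \<Sum>z\<in>Z. of_bool (p y < p x \<and> p z < p x))"
  unfolding last_triples_def real_cnt_eq_sum[OF assms(1)] real_cnt_eq_sum[OF assms(2)]
  by (simp only: of_bool_conj) (simp only: sum_product)

lemma inj_on_comparable:
  fixes p :: "'v \<Rightarrow> nat"
  assumes "inj_on p W" "X \<subseteq> W" "Y \<subseteq> W" "X \<inter> Y = {}" "x \<in> X" "y \<in> Y"
  shows "p x < p y \<or> p y < p x"
proof -
  have "x \<noteq> y" using assms(4-6) by blast
  with assms have "p x \<noteq> p y" by (meson inj_onD subsetD)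
  then show ?thesis by (simp only: neq_iff)
qed

text \<open>Every triple with one vertex from each part has exactly one last vertex.\<close>

lemma last_triples_total:
  assumes fin: "finite A" "finite B" "finite C" and inj: "inj_on p (A \<union> B \<union> C)"
    and disj: "A \<inter> B = {}" "A \<inter> C = {}" "B \<inter> C = {}"
  shows "last_triples p A B C + last_triples p B A C + last_triples p C A B
    = real (card A) * real (card B) * real (card C)"
proof -
  let ?l = "\<lambda>a b c. of_bool (p b < p a \<and> p c < p a) :: real"
  have B: "last_triples p B A C = (\<Sum>a\<in>A. \<Sum>b\<in>B. \<Sum>c\<in>C. ?l b a c)"
    unfolding last_triples_eq_sum[OF fin(1,3)] by (rule sum.swap)
  have "last_triples p C A B = (\<Sum>a\<in>A. \<Sum>c\<in>C. \<Sum>b\<in>B. ?l c a b)"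
    unfolding last_triples_eq_sum[OF fin(1,2)] by (rule sum.swap)
  also have "\<dots> = (\<Sum>a\<in>A. \<Sum>b\<in>B. \<Sum>c\<in>C. ?l c a b)"
    by (intro sum.cong refl sum.swap)
  finally have "last_triples p A B C + last_triples p B A C + last_triples p C A B
    = (\<Sum>a\<in>A. \<Sum>b\<in>B. \<Sum>c\<in>C. ?l a b c + ?l b a c + ?l c a b)"
    unfolding last_triples_eq_sum[OF fin(2,3)] B by (simp only: sum.distrib)
  also have "\<dots> = (\<Sum>a\<in>A. \<Sum>b\<in>B. \<Sum>c\<in>C. 1)"
  proof (intro sum.cong refl)
    fix a b c assume "a \<in> A" "b \<in> B" "c \<in> C"
    then have "p a < p b \<or> p b < p a" "p a < p c \<or> p c < p a" "p b < p c \<or> p c < p b"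
      using inj_on_comparable[OF inj _ _ disj(1)] inj_on_comparable[OF inj _ _ disj(2)] inj_on_comparable[OF inj _ _ disj(3)]
      by blast+
    then show "?l a b c + ?l b a c + ?l c a b = 1"
      by (elim disjE) simp_all
  qed
  finally show ?thesis by simp
qed

text \<open>By \<open>max_cnt\<close>, the maximum counts the \<open>x\<close> that precede
  \<open>y\<close> or \<open>z\<close>, that is, all \<open>x\<close> except those coming after
  both.\<close>

lemma sum_max_cnt:
  assumes fin: "finite X" "finite Y" "finite Z" and inj: "inj_on p (X \<union> Y \<union> Z)"
    and disj: "X \<inter> Y = {}" "X \<inter> Z = {}"
  shows "(\<Sum>y\<in>Y. \<Sum>z\<in>Z. max (real (cnt p X y)) (real (cnt p X z)))
    = real (card X) * real (card Y) * real (card Z) - last_triples p X Y Z"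
proof -
  have *: "max (real (cnt p X y)) (real (cnt p X z)) = (\<Sum>x\<in>X. 1 - of_bool (p y < p x \<and> p z < p x))"
    if "y \<in> Y" "z \<in> Z" for y z
  proof -
    have "max (real (cnt p X y)) (real (cnt p X z)) = real (card {x \<in> X. p x < p y \<or> p x < p z})"
      by (simp only: max_cnt[OF fin(1), symmetric] of_nat_max)
    also have "\<dots> = (\<Sum>x\<in>X. of_bool (p x < p y \<or> p x < p z))"
      using fin by (simp only: sum_of_bool_eq Int_def mem_Collect_eq)
    also have "\<dots> = (\<Sum>x\<in>X. 1 - of_bool (p y < p x \<and> p z < p x))"
    proof (rule sum.cong[OF refl])
      fix x assume "x \<in> X"
      then have "p x < p y \<or> p y < p x" "p x < p z \<or> p z < p x"
        using inj_on_comparable[OF inj, of X Y] inj_on_comparable[OF inj, of X Z] disj that by auto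
      then show "of_bool (p x < p y \<or> p x < p z) = 1 - (of_bool (p y < p x \<and> p z < p x) :: real)"
        by (elim disjE) simp_all
    qed
    finally show ?thesis .
  qed
  have "(\<Sum>y\<in>Y. \<Sum>z\<in>Z. max (real (cnt p X y)) (real (cnt p X z)))
     = (\<Sum>y\<in>Y. \<Sum>z\<in>Z. \<Sum>x\<in>X. 1 - of_bool (p y < p x \<and> p z < p x))"
    by (intro sum.cong refl *)
  also have "\<dots> = (\<Sum>y\<in>Y. \<Sum>x\<in>X. \<Sum>z\<in>Z. 1 - of_bool (p y < p x \<and> p z < p x))"
    by (intro sum.cong refl sum.swap)
  also have "\<dots> = (\<Sum>x\<in>X. \<Sum>y\<in>Y. \<Sum>z\<in>Z. 1 - of_bool (p y < p x \<and> p z < p x))"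
    by (rule sum.swap)
  also have "\<dots> = (\<Sum>x\<in>X. \<Sum>y\<in>Y. \<Sum>z\<in>Z. 1) - last_triples p X Y Z"
    unfolding last_triples_eq_sum[OF fin(2,3)] by (simp only: sum_subtractf)
  finally show ?thesis by simp
qed

section \<open>Pair sums as charges to single vertices\<close>

text \<open>For each \<open>y\<close>, the number of ordered pairs of distinct vertices of
  \<open>X\<close> that precede \<open>y\<close>.\<close>

definition pairsum :: "('v \<Rightarrow> nat) \<Rightarrow> 'v set \<Rightarrow> 'v set \<Rightarrow> real" where
  "pairsum p X Y = (\<Sum>y\<in>Y. real (cnt p X y) * (real (cnt p X y) - 1))"

lemma sum_lessThan_real: "(\<Sum>i<n. real i) = real n * (real n - 1) / 2"
  by (induction n) (simp_all add: algebra_simps)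

lemma sum_lessThan_real_squares: "(\<Sum>i<n. (real i)\<^sup>2) = real n * (real n - 1) * (2 * real n - 1) / 6"
  by (induction n) (simp_all add: algebra_simps power2_eq_square)

text \<open>Double counting: an unordered pair of \<open>X\<close> in front of \<open>y\<close> is
  charged to its later vertex \<open>x\<close>, for which there are \<open>cnt p X x\<close>
  partners and \<open>card Y - cnt p Y x\<close> choices of \<open>y\<close>. This turns a sum over
  \<open>Y\<close> into one over \<open>X\<close>.\<close>

lemma pairsum_eq_rank_sum:
  assumes fin: "finite X" "finite Y" and inj: "inj_on p (X \<union> Y)" and disj: "X \<inter> Y = {}"
  shows "pairsum p X Y = 2 * (\<Sum>x\<in>X. real (cnt p X x) * (real (card Y) - real (cnt p Y x)))"
proof -
  have *: "real (cnt p X y) * (real (cnt p X y) - 1) = 2 * (\<Sum>x\<in>X. of_bool (p x < p y) * real (cnt p X x))" for y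
  proof -
    let ?L = "{x \<in> X. p x < p y}"
    have "(\<Sum>x\<in>X. of_bool (p x < p y) * real (cnt p X x)) = (\<Sum>x\<in>?L. real (cnt p X x))"
      using fin by (simp add: Int_def)
    \<comment> \<open>\<open>?L\<close> is an initial segment of \<open>X\<close>, so ranks in
      \<open>X\<close> and in \<open>?L\<close> agree on it and run through
      \<open>0, ..., card ?L - 1\<close>.\<close>
    also have "\<dots> = (\<Sum>x\<in>?L. real (cnt p ?L x))"
    proof (rule sum.cong[OF refl])
      fix x assume "x \<in> ?L"
      then have "{x' \<in> X. p x' < p x} = {x' \<in> ?L. p x' < p x}" by auto
      then show "real (cnt p X x) = real (cnt p ?L x)" by (simp only: cnt_def)
    qed
    also have "\<dots> = (\<Sum>i<card ?L. real i)"
      by (rule sum_cnt) (use fin in \<open>auto intro: inj_on_subset[OF inj]\<close>)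
    finally show ?thesis by (simp add: sum_lessThan_real cnt_def)
  qed
  have "pairsum p X Y = 2 * (\<Sum>y\<in>Y. \<Sum>x\<in>X. of_bool (p x < p y) * real (cnt p X x))"
    unfolding pairsum_def * by (simp only: sum_distrib_left)
  also have "\<dots> = 2 * (\<Sum>x\<in>X. \<Sum>y\<in>Y. of_bool (p x < p y) * real (cnt p X x))"
    by (subst sum.swap) (rule refl)
  also have "(\<Sum>x\<in>X. \<Sum>y\<in>Y. of_bool (p x < p y) * real (cnt p X x))
     = (\<Sum>x\<in>X. real (cnt p X x) * (real (card Y) - real (cnt p Y x)))"
  proof (rule sum.cong[OF refl])
    fix x assume x: "x \<in> X"
    have "(\<Sum>y\<in>Y. of_bool (p x < p y) :: real) = (\<Sum>y\<in>Y. 1 - of_bool (p y < p x))"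
    proof (rule sum.cong[OF refl])
      fix y assume "y \<in> Y"
      with x have "p x < p y \<or> p y < p x" using inj_on_comparable[OF inj, of X Y] disj by auto
      then show "of_bool (p x < p y) = (1 - of_bool (p y < p x) :: real)" by (elim disjE) simp_all
    qed
    also have "\<dots> = real (card Y) - real (cnt p Y x)"
      using fin by (simp add: real_cnt_eq_sum sum_subtractf)
    finally have "(\<Sum>y\<in>Y. of_bool (p x < p y) :: real) = real (card Y) - real (cnt p Y x)" .
    then show "(\<Sum>y\<in>Y. of_bool (p x < p y) * real (cnt p X x)) = real (cnt p X x) * (real (card Y) - real (cnt p Y x))"
      by (simp only: sum_distrib_right[symmetric]) (rule mult.commute)
  qed
  finally show ?thesis .
qed

lemma sepsum_eq_last_triples:
  assumes fin: "finite X" "finite Y" "finite Z" and inj: "inj_on p (X \<union> Y \<union> Z)"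
    and disj: "X \<inter> Y = {}" "X \<inter> Z = {}" "Y \<inter> Z = {}"
  shows "2 * sepsum p X Y Z = 2 * (real (card X) - 1) *
    (real (card X) * real (card Y) * real (card Z) - last_triples p X Y Z)
    - real (card Z) * pairsum p X Y - real (card Y) * pairsum p X Z"
proof -
  have YZ: "offdiag Y Z = Y \<times> Z" using disj(3) by (auto simp: offdiag_def)
  have "2 * sepsum p X Y Z = (\<Sum>y\<in>Y. \<Sum>z\<in>Z.
    2 * (real (card X) - 1) * max (real (cnt p X y)) (real (cnt p X z))
      - real (cnt p X y) * (real (cnt p X y) - 1) - real (cnt p X z) * (real (cnt p X z) - 1))"
    unfolding sepsum_eq[OF fin(1) inj disj(1,2)] YZ by (rule sum.cartesian_product[symmetric])
  also have "\<dots> = 2 * (real (card X) - 1) * (\<Sum>y\<in>Y. \<Sum>z\<in>Z. max (real (cnt p X y)) (real (cnt p X z)))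
    - real (card Z) * pairsum p X Y - real (card Y) * pairsum p X Z"
    by (simp only: sum_subtractf sum_distrib_left pairsum_def sum_constant)
  finally show ?thesis unfolding sum_max_cnt[OF fin inj disj(1,2)] .
qed

section \<open>Integer inequalities for optimising a single charge\<close>

lemma int_sq_ge_self: "(0::real) \<le> of_int k * (of_int k - 1)"
proof -
  have "0 \<le> k * (k - 1)" by (cases "k \<le> 0") (auto intro: mult_nonpos_nonpos mult_nonneg_nonneg)
  then have "0 \<le> real_of_int (k * (k - 1))" by linarith
  then show ?thesis by simp
qed

text \<open>For nonnegative \<open>k\<close> both terms are nonnegative. For negative
  \<open>k\<close>, replacing \<open>c\<close> by the larger \<open>m\<close> only decreases the
  value, and leaves m times the product of the consecutive integers \<open>k\<close> and
  \<open>k + 1\<close>.\<close>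

lemma convex_step:
  fixes k :: int and c m :: real
  assumes "0 \<le> c" "c \<le> m"
  shows "0 \<le> m * (of_int k * (of_int k - 1)) + 2 * of_int k * c"
proof (cases "k \<ge> 0")
  case True
  then show ?thesis using int_sq_ge_self[of k] assms by simp
next
  case False
  have "0 \<le> m * (of_int (k + 1) * (of_int (k + 1) - 1))"
    using assms by (intro mult_nonneg_nonneg[OF _ int_sq_ge_self]) simp
  moreover have "2 * of_int k * m \<le> 2 * of_int k * c"
    using assms False by (intro mult_left_mono_neg) auto
  ultimately show ?thesis by (simp add: algebra_simps)
qed

text \<open>The two sides differ by \<open>(b - r) * (b - r - 1)\<close>, a product of consecutive
  integers. The minimum over \<open>b\<close> is thus attained at \<open>b = r\<close>.\<close>

lemma pair_weight_min:
  fixes r b :: nat and m :: real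
  shows "2 * real r * (m - r) + real r * (real r - 1) \<le> 2 * real r * (m - b) + real b * (real b - 1)"
proof -
  have "0 \<le> (real b - real r) * (real b - real r - 1)"
    using int_sq_ge_self[of "int b - int r"] by simp
  also have "\<dots> = 2 * real r * (m - b) + real b * (real b - 1) - (2 * real r * (m - r) + real r * (real r - 1))"
    by algebra
  finally show ?thesis by simp
qed

text \<open>The difference of the sides splits into two instances of \<open>convex_step\<close>:
  first \<open>b\<close> is moved to \<open>r\<close> while \<open>c\<close> is kept, then
  \<open>c\<close> is moved to \<open>r\<close> with \<open>b = r\<close> in place.\<close>

lemma triple_weight_min:
  fixes r b c :: nat and m :: real
  assumes "real r \<le> m" "real c \<le> m"
  shows "2 * m * (2 * real r * (m - r) + real r * (real r - 1)) + 2 * (real r)\<^sup>2 \<le>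
    m * (2 * real r * (m - b) + real b * (real b - 1) + 2 * real r * (m - c) + real c * (real c - 1))
    + 2 * real b * real c"
proof -
  let ?l = "2 * m * (2 * real r * (m - r) + real r * (real r - 1)) + 2 * (real r)\<^sup>2"
  let ?r = "m * (2 * real r * (m - b) + real b * (real b - 1) + 2 * real r * (m - c) + real c * (real c - 1))
    + 2 * real b * real c"
  let ?\<beta> = "real b - real r" and ?\<gamma> = "real c - real r"
  have "0 \<le> m * (?\<beta> * (?\<beta> - 1)) + 2 * ?\<beta> * real c"
    using convex_step[of "real c" m "int b - int r"] assms by simp
  moreover have "0 \<le> m * (?\<gamma> * (?\<gamma> - 1)) + 2 * ?\<gamma> * real r"
    using convex_step[of "real r" m "int c - int r"] assms by simp
  moreover have "?r - ?l = (m * (?\<beta> * (?\<beta> - 1)) + 2 * ?\<beta> * real c) + (m * (?\<gamma> * (?\<gamma> - 1)) + 2 * ?\<gamma> * real r)"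
    by algebra
  ultimately show ?thesis by linarith
qed

text \<open>The vertices of the large part decouple: each contributes a term that is least when equally many
  vertices of all three parts precede it.\<close>

lemma sepsum_tripartite_le:
  fixes m :: nat
  assumes fin: "finite A" "finite B" "finite C" and inj: "inj_on p (A \<union> B \<union> C)"
    and disj: "A \<inter> B = {}" "A \<inter> C = {}" "B \<inter> C = {}"
    and card: "card A = m + 1" "card B = m" "card C = m"
  shows "sepsum p A B C + sepsum p B A C + sepsum p C A B
    \<le> real m * (real m + 1) * (3 * real m - 2) * (2 * real m + 1) / 6"
proof -
  let ?M = "real m"
  have inj': "inj_on p (B \<union> A \<union> C)" "inj_on p (C \<union> A \<union> B)" "inj_on p (A \<union> B)" "inj_on p (A \<union> C)" "inj_on p (C \<union> B)"
    "inj_on p A" "inj_on p C"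
    by (rule inj_on_subset[OF inj]; blast)+
  have disj': "B \<inter> A = {}" "C \<inter> A = {}" "C \<inter> B = {}" using disj by auto
  note sA = sepsum_eq_last_triples[OF fin inj disj]
  note sB = sepsum_eq_last_triples[OF fin(2,1,3) inj'(1) disj'(1) disj(3,2)]
  note sC = sepsum_eq_last_triples[OF fin(3,1,2) inj'(2) disj'(2,3) disj(1)]
  \<comment> \<open>Pair sums between \<open>A\<close> and another part carry the weight
    \<open>m\<close>, the size of the remaining part. Written over the vertices of \<open>A\<close>,
    they and \<open>last_triples p A B C\<close> give each vertex one charge, depending on its rank
    in \<open>A\<close> and on the numbers of vertices of \<open>B\<close> and \<open>C\<close>
    before it.\<close>
  have bound_A: "(\<Sum>r<m + 1. 2 * ?M * (2 * real r * (?M - r) + real r * (real r - 1)) + 2 * (real r)\<^sup>2)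
    \<le> ?M * (pairsum p A B + pairsum p A C + pairsum p B A + pairsum p C A) + 2 * last_triples p A B C"
  proof -
    have "(\<Sum>r<m + 1. 2 * ?M * (2 * real r * (?M - r) + real r * (real r - 1)) + 2 * (real r)\<^sup>2)
      = (\<Sum>x\<in>A. 2 * ?M * (2 * real (cnt p A x) * (?M - cnt p A x) + real (cnt p A x) * (real (cnt p A x) - 1))
           + 2 * (real (cnt p A x))\<^sup>2)"
      unfolding card(1)[symmetric] by (rule sum_cnt[OF fin(1) inj'(6), symmetric])
    also have "\<dots> \<le> (\<Sum>x\<in>A. ?M * (2 * real (cnt p A x) * (?M - cnt p B x) + real (cnt p B x) * (real (cnt p B x) - 1)
       + 2 * real (cnt p A x) * (?M - cnt p C x) + real (cnt p C x) * (real (cnt p C x) - 1))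
       + 2 * real (cnt p B x) * real (cnt p C x))"
    proof (intro sum_mono triple_weight_min)
      fix x assume "x \<in> A"
      then have "cnt p A x < m + 1" using bij_betw_cnt[OF fin(1) inj'(6)] card by (auto simp: bij_betw_def)
      then show "real (cnt p A x) \<le> ?M" by simp
      have "cnt p C x \<le> card C" unfolding cnt_def using fin by (intro card_mono) auto
      then show "real (cnt p C x) \<le> ?M" using card by simp
    qed
    also have "\<dots> = ?M * (pairsum p A B + pairsum p A C + pairsum p B A + pairsum p C A) + 2 * last_triples p A B C"
      unfolding pairsum_eq_rank_sum[OF fin(1,2) inj'(3) disj(1)] pairsum_eq_rank_sum[OF fin(1,3) inj'(4) disj(2)]
      unfolding pairsum_def last_triples_def card
      by (simp add: sum.distrib sum_distrib_left distrib_left mult.assoc mult.left_commute)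
    finally show ?thesis .
  qed
  \<comment> \<open>The pair sums between \<open>B\<close> and \<open>C\<close> do not involve
    \<open>A\<close>; they are charged to the vertices of \<open>C\<close> and minimised
    separately.\<close>
  have bound_BC: "(\<Sum>r<m. 2 * real r * (?M - r) + real r * (real r - 1)) \<le> pairsum p B C + pairsum p C B"
  proof -
    have "(\<Sum>r<m. 2 * real r * (?M - r) + real r * (real r - 1))
      = (\<Sum>x\<in>C. 2 * real (cnt p C x) * (?M - cnt p C x) + real (cnt p C x) * (real (cnt p C x) - 1))"
      unfolding card(3)[symmetric] by (rule sum_cnt[OF fin(3) inj'(7), symmetric])
    also have "\<dots> \<le> (\<Sum>x\<in>C. 2 * real (cnt p C x) * (?M - cnt p B x) + real (cnt p B x) * (real (cnt p B x) - 1))"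
      by (intro sum_mono pair_weight_min)
    also have "\<dots> = pairsum p B C + pairsum p C B"
      unfolding pairsum_eq_rank_sum[OF fin(3,2) inj'(5) disj'(3)]
      unfolding pairsum_def card
      by (simp add: sum.distrib sum_distrib_left distrib_left mult.assoc mult.left_commute)
    finally show ?thesis .
  qed
  have "(\<Sum>r<m + 1. 2 * ?M * (2 * real r * (?M - r) + real r * (real r - 1)) + 2 * (real r)\<^sup>2)
      = (\<Sum>r<m+1. (2 * ?M * (2 * ?M - 1)) * real r + (2 - 2 * ?M) * (real r)\<^sup>2)"
    by (intro sum.cong refl) (simp add: algebra_simps power2_eq_square)
  also have "\<dots> = 2 * ?M * (2 * ?M - 1) * ((?M + 1) * ?M / 2) + (2 - 2 * ?M) * ((?M + 1) * ?M * (2 * ?M + 1) / 6)"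
    unfolding sum.distrib sum_distrib_left[symmetric] sum_lessThan_real sum_lessThan_real_squares
    by (simp add: algebra_simps)
  finally have cA: "2 * ?M * (2 * ?M - 1) * ((?M + 1) * ?M / 2) + (2 - 2 * ?M) * ((?M + 1) * ?M * (2 * ?M + 1) / 6)
    \<le> ?M * (pairsum p A B + pairsum p A C + pairsum p B A + pairsum p C A) + 2 * last_triples p A B C"
    using bound_A by simp
  have "(\<Sum>r<m. 2 * real r * (?M - r) + real r * (real r - 1)) = (\<Sum>r<m. (2 * ?M - 1) * real r - (real r)\<^sup>2)"
    by (intro sum.cong refl) (simp add: algebra_simps power2_eq_square)
  also have "\<dots> = (2 * ?M - 1) * (?M * (?M - 1) / 2) - ?M * (?M - 1) * (2 * ?M - 1) / 6"
    unfolding sum_subtractf sum_distrib_left[symmetric] sum_lessThan_real sum_lessThan_real_squares ..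
  finally have cBC: "(?M + 1) * ((2 * ?M - 1) * (?M * (?M - 1) / 2) - ?M * (?M - 1) * (2 * ?M - 1) / 6)
    \<le> (?M + 1) * (pairsum p B C + pairsum p C B)"
    using bound_BC by (intro mult_left_mono) auto
  have total: "last_triples p A B C + last_triples p B A C + last_triples p C A B = (?M + 1) * ?M * ?M"
    using last_triples_total[OF fin inj disj] unfolding card by (simp add: algebra_simps)
  \<comment> \<open>The three separation counts contain the triples ending in \<open>A\<close> with
    coefficient \<open>-2m\<close> and those ending in \<open>B\<close> or \<open>C\<close> with
    \<open>-2(m - 1)\<close>. Since the total is fixed, only
    \<open>-2 * last_triples p A B C\<close> and a constant remain.\<close>
  have lA: "last_triples p A B C = (?M + 1) * ?M * ?M - last_triples p B A C - last_triples p C A B"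
    using total by linarith
  have tot: "2 * (sepsum p A B C + sepsum p B A C + sepsum p C A B) =
     (4 * ?M - 2) * ((?M + 1) * ?M * ?M)
     - (?M * (pairsum p A B + pairsum p A C + pairsum p B A + pairsum p C A) + 2 * last_triples p A B C)
     - (?M + 1) * (pairsum p B C + pairsum p C B)"
    unfolding distrib_left[of 2] sA sB sC card lA by (simp add: algebra_simps)
  have "2 * (sepsum p A B C + sepsum p B A C + sepsum p C A B) \<le> (4 * ?M - 2) * ((?M + 1) * ?M * ?M)
     - (2 * ?M * (2 * ?M - 1) * ((?M + 1) * ?M / 2) + (2 - 2 * ?M) * ((?M + 1) * ?M * (2 * ?M + 1) / 6))
     - (?M + 1) * ((2 * ?M - 1) * (?M * (?M - 1) / 2) - ?M * (?M - 1) * (2 * ?M - 1) / 6)"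
    unfolding tot by (intro diff_mono order_refl cA cBC)
  also have "\<dots> = 2 * (?M * (?M + 1) * (3 * ?M - 2) * (2 * ?M + 1) / 6)"
    by (simp add: algebra_simps add_divide_distrib diff_divide_distrib)
  finally show ?thesis by (simp only: mult_le_cancel_left_pos[OF zero_less_numeral])
qed

section \<open>Layered orders\<close>

definition part_size :: "nat \<Rightarrow> nat \<Rightarrow> nat" where
  "part_size m i = (if i = 0 then m + 1 else m)"

definition part :: "nat \<Rightarrow> nat \<Rightarrow> (nat \<times> nat) set" where
  "part m i = {i} \<times> {..<part_size m i}"

text \<open>Layer \<open>j\<close> consists of the \<open>j\<close>-th vertices of all parts, ordered by \<open>w\<close>.\<close>

definition layered :: "(nat \<Rightarrow> nat) \<Rightarrow> nat \<times> nat \<Rightarrow> nat" where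
  "layered w v = 3 * snd v + w (fst v)"

text \<open>Part 0 has to come first in each layer: its surplus vertex forms the last, incomplete
  layer, so the order ends as in A B C ... A B C A.\<close>

definition layer_order :: "(nat \<Rightarrow> nat) \<Rightarrow> bool" where
  "layer_order w \<longleftrightarrow> inj_on w {0, 1, 2} \<and> w 0 = 0 \<and> w 1 < 3 \<and> w 2 < 3"

lemma finite_part [simp]: "finite (part m i)"
  by (simp add: part_def)

lemma card_part [simp]: "card (part m i) = part_size m i"
  by (simp add: part_def card_cartesian_product)

lemma sum_part: "(\<Sum>v\<in>part m i. f v) = (\<Sum>j<part_size m i. f (i, j))"
proof -
  have "part m i = Pair i ` {..<part_size m i}" by (auto simp: part_def)
  then show ?thesis by (simp add: sum.reindex inj_on_def)
qed

lemma part_disjoint: "i \<noteq> j \<Longrightarrow> part m i \<inter> part m j = {}"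
  by (auto simp: part_def)

lemma layer_orderD:
  assumes "layer_order w"
  shows "i < 3 \<Longrightarrow> w i < 3" "i < 3 \<Longrightarrow> k < 3 \<Longrightarrow> w i = w k \<Longrightarrow> i = k" "w 0 = 0"
proof -
  have three: "i < 3 \<Longrightarrow> i = 0 \<or> i = 1 \<or> i = 2" for i :: nat by auto
  show "i < 3 \<Longrightarrow> w i < 3" using assms three[of i] by (auto simp: layer_order_def)
  show "i < 3 \<Longrightarrow> k < 3 \<Longrightarrow> w i = w k \<Longrightarrow> i = k"
    using assms three[of i] three[of k] inj_onD[of w "{0,1,2}" i k] by (auto simp: layer_order_def)
  show "w 0 = 0" using assms by (simp add: layer_order_def)
qed

lemma layered_less_iff:
  assumes "layer_order w" "i < 3" "k < 3" "i \<noteq> k"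
  shows "layered w (i, x) < layered w (k, j) \<longleftrightarrow> x < j + of_bool (w i < w k)"
  using layer_orderD(1)[OF assms(1), of i] layer_orderD(1)[OF assms(1), of k] layer_orderD(2)[OF assms(1), of i k] assms(2-)
  by (cases "w i < w k") (auto simp: layered_def)

lemma inj_on_layered:
  assumes "layer_order w"
  shows "inj_on (layered w) ({..<3} \<times> UNIV)"
proof (rule inj_onI)
  fix u v :: "nat \<times> nat"
  assume uv: "u \<in> {..<3} \<times> UNIV" "v \<in> {..<3} \<times> UNIV" and eq: "layered w u = layered w v"
  obtain i x k y where u: "u = (i, x)" and v: "v = (k, y)" by fastforce
  have "w i < 3" "w k < 3" using uv layer_orderD(1)[OF assms] by (auto simp: u v)
  moreover have "3 * x + w i = 3 * y + w k" using eq by (simp add: u v layered_def)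
  ultimately have "x = y" by linarith
  with \<open>3 * x + w i = 3 * y + w k\<close> have "w i = w k" by simp
  with \<open>x = y\<close> show "u = v" using uv layer_orderD(2)[OF assms, of i k] by (auto simp: u v)
qed

lemma cnt_layered:
  assumes w: "layer_order w" and "i < 3" "k < 3" "i \<noteq> k" "j < part_size m k"
  shows "cnt (layered w) (part m i) (k, j) = j + of_bool (w i < w k)"
proof -
  \<comment> \<open>The count is not cut off by the size of part \<open>i\<close>. The critical
    value \<open>j = m\<close> occurs only for \<open>k = 0\<close>, where \<open>w 0 = 0\<close>
    makes the extra summand vanish.\<close>
  have "j + of_bool (w i < w k) \<le> part_size m i"
    using assms layer_orderD(3)[OF w] by (auto simp: part_size_def of_bool_def split: if_splits)
  moreover have "(v \<in> part m i \<and> layered w v < layered w (k, j)) = (v \<in> {i} \<times> {..<part_size m i} \<and> snd v < j + of_bool (w i < w k))" for v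
    using layered_less_iff[OF w assms(2-4), of "snd v" j] by (cases v) (auto simp: part_def)
  ultimately have "{v \<in> part m i. layered w v < layered w (k, j)} = {i} \<times> {..<j + of_bool (w i < w k)}"
    by auto
  then show ?thesis by (simp only: cnt_def card_cartesian_product) simp
qed

text \<open>The right-hand side of \<open>count_separated\<close> as a function of the two counts:
  twice the number of separated pairs for fixed \<open>y\<close> and \<open>z\<close>.\<close>

definition sep_weight :: "real \<Rightarrow> real \<Rightarrow> real \<Rightarrow> real" where
  "sep_weight n a b = 2 * (n - 1) * max a b - a * (a - 1) - b * (b - 1)"

lemma sum_offdiag_same:
  assumes "finite Y"
  shows "(\<Sum>(y, z)\<in>offdiag Y Y. f y z) = (\<Sum>y\<in>Y. \<Sum>z\<in>Y. f y z) - (\<Sum>y\<in>Y. f y y :: real)"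
proof -
  have "(\<Sum>y\<in>Y. \<Sum>z\<in>Y. f y z) = (\<Sum>(y, z)\<in>Y \<times> Y. f y z)"
    by (rule sum.cartesian_product)
  also have "Y \<times> Y = offdiag Y Y \<union> (\<lambda>y. (y, y)) ` Y" by (auto simp: offdiag_def)
  also have "(\<Sum>(y, z)\<in>\<dots>. f y z) = (\<Sum>(y, z)\<in>offdiag Y Y. f y z) + (\<Sum>(y, z)\<in>(\<lambda>y. (y, y)) ` Y. f y z)"
    using assms by (intro sum.union_disjoint finite_offdiag finite_imageI) (auto simp: offdiag_def)
  also have "(\<Sum>(y, z)\<in>(\<lambda>y. (y, y)) ` Y. f y z) = (\<Sum>y\<in>Y. f y y)"
    by (subst sum.reindex) (auto simp: inj_on_def)
  finally show ?thesis by simp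
qed

lemma sepsum_layered_eq:
  assumes w: "layer_order w" and i: "i < 3" "j < 3" "k < 3" "i \<noteq> j" "i \<noteq> k"
  shows "2 * sepsum (layered w) (part m i) (part m j) (part m k) =
    (\<Sum>(y, z)\<in>offdiag (part m j) (part m k). sep_weight (part_size m i)
       (snd y + of_bool (w i < w j)) (snd z + of_bool (w i < w k)))"
proof -
  have "part m i \<union> part m j \<union> part m k \<subseteq> {..<3} \<times> UNIV" using i by (auto simp: part_def)
  then have inj: "inj_on (layered w) (part m i \<union> part m j \<union> part m k)"
    by (rule inj_on_subset[OF inj_on_layered[OF w]])
  show ?thesis
    unfolding sepsum_eq[OF finite_part inj part_disjoint[OF i(4)] part_disjoint[OF i(5)]]
  proof (rule sum.cong[OF refl], clarify)
    fix a b c d assume "((a, b), (c, d)) \<in> offdiag (part m j) (part m k)"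
    then have "a = j" "c = k" and b: "b < part_size m j" and d: "d < part_size m k"
      by (auto simp: offdiag_def part_def)
    then show "2 * (real (card (part m i)) - 1) * max (real (cnt (layered w) (part m i) (a, b))) (real (cnt (layered w) (part m i) (c, d)))
      - real (cnt (layered w) (part m i) (a, b)) * (real (cnt (layered w) (part m i) (a, b)) - 1)
      - real (cnt (layered w) (part m i) (c, d)) * (real (cnt (layered w) (part m i) (c, d)) - 1)
      = sep_weight (part_size m i) (snd (a, b) + of_bool (w i < w j)) (snd (c, d) + of_bool (w i < w k))"
      using cnt_layered[OF w i(1) i(2) i(4) b] cnt_layered[OF w i(1) i(3) i(5) d]
      by (simp add: sep_weight_def)
  qed
qed

lemma sepsum_layered_distinct:
  assumes w: "layer_order w" and i: "i < 3" "j < 3" "k < 3" "i \<noteq> j" "i \<noteq> k" and "j \<noteq> k"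
  shows "2 * sepsum (layered w) (part m i) (part m j) (part m k) =
    (\<Sum>y<part_size m j. \<Sum>z<part_size m k. sep_weight (part_size m i)
       (y + of_bool (w i < w j)) (z + of_bool (w i < w k)))"
proof -
  have "offdiag (part m j) (part m k) = part m j \<times> part m k"
    using part_disjoint[OF \<open>j \<noteq> k\<close>, of m] by (auto simp: offdiag_def)
  then show ?thesis
    unfolding sepsum_layered_eq[OF w i] by (simp only: sum.cartesian_product[symmetric] sum_part snd_conv)
qed

lemma sepsum_layered_same:
  assumes w: "layer_order w" and i: "i < 3" "j < 3" "i \<noteq> j"
  shows "2 * sepsum (layered w) (part m i) (part m j) (part m j) =
    (\<Sum>y<part_size m j. \<Sum>z<part_size m j. sep_weight (part_size m i)
       (y + of_bool (w i < w j)) (z + of_bool (w i < w j)))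
    - (\<Sum>y<part_size m j. sep_weight (part_size m i) (y + of_bool (w i < w j)) (y + of_bool (w i < w j)))"
  unfolding sepsum_layered_eq[OF w i(1,2,2,3,3)] by (simp only: sum_offdiag_same[OF finite_part] sum_part snd_conv)

section \<open>Closed forms for sums over the layers\<close>

lemma sum_lessThan_real_Suc: "(\<Sum>y<m. real y + 1) = real m * (real m + 1) / 2"
  by (induction m) (simp_all add: algebra_simps)

lemma sum_sum_max: "(\<Sum>y<m. \<Sum>z<m. max (real y) (real z)) = real m * (real m - 1) * (4 * real m + 1) / 6"
proof (induction m)
  case (Suc m)
  have "(\<Sum>y<m. max (real y) (real m)) = (\<Sum>y<m. real m)" "(\<Sum>z<m. max (real m) (real z)) = (\<Sum>y<m. real m)"
    by (intro sum.cong; simp)+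
  then show ?case using Suc by (simp add: sum.distrib algebra_simps)
qed simp

lemma sum_sum_max_Suc:
  "(\<Sum>y<m. \<Sum>z<m. max (real y + 1) (real z + 1)) = real m * (real m + 1) * (4 * real m - 1) / 6"
proof -
  have "max (real y + 1) (real z + 1) = max (real y) (real z) + 1" for y z by simp
  then show ?thesis by (simp add: sum.distrib sum_sum_max algebra_simps diff_divide_distrib)
qed

lemma sum_sum_max_rect:
  "(\<Sum>y<m + 1. \<Sum>z<m. max (real y) (real z)) = real m * (real m - 1) * (4 * real m + 1) / 6 + real m * real m"
proof -
  have "(\<Sum>z<m. max (real m) (real z)) = (\<Sum>y<m. real m)" by (intro sum.cong; simp)
  then show ?thesis by (simp add: sum_sum_max)
qed

text \<open>Splitting off the row \<open>y = 0\<close> and shifting the other rows by one leaves the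
  square sum \<open>sum_sum_max_Suc\<close>.\<close>

lemma sum_sum_max_rect_Suc:
  "(\<Sum>y<m + 1. \<Sum>z<m. max (real y) (real z + 1)) =
     real m * (real m + 1) * (4 * real m - 1) / 6 + real m * (real m + 1) / 2"
proof -
  have "(\<Sum>z<m. max 0 (real z + 1)) = (\<Sum>z<m. real z + 1)" by (intro sum.cong; simp)
  also have "\<dots> = real m * (real m + 1) / 2" by (rule sum_lessThan_real_Suc)
  finally have "(\<Sum>z<m. max 0 (real z + 1)) = real m * (real m + 1) / 2" .
  moreover have "(\<Sum>y<m. \<Sum>z<m. max (real (Suc y)) (real z + 1)) = real m * (real m + 1) * (4 * real m - 1) / 6"
    unfolding sum_sum_max_Suc[symmetric] by (simp add: add.commute)
  ultimately show ?thesis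
    unfolding Suc_eq_plus1[symmetric] sum.lessThan_Suc_shift by simp
qed

lemma sum_falling: "(\<Sum>y<m. real y * (real y - 1)) = real m * (real m - 1) * (real m - 2) / 3"
  by (induction m) (simp_all add: algebra_simps)

lemma sum_rising: "(\<Sum>y<m. (real y + 1) * (real y + 1 - 1)) = real m * (real m - 1) * (real m + 1) / 3"
  by (induction m) (simp_all add: algebra_simps)

lemma sum_sum_sep_weight:
  "(\<Sum>y<a. \<Sum>z<b. sep_weight n (f y) (g z)) = 2 * (n - 1) * (\<Sum>y<a. \<Sum>z<b. max (f y) (g z))
     - real b * (\<Sum>y<a. f y * (f y - 1)) - real a * (\<Sum>z<b. g z * (g z - 1))"
  unfolding sep_weight_def by (simp only: sum_subtractf sum_distrib_left sum_constant card_lessThan)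

lemma sum_sep_weight_same:
  "(\<Sum>y<a. sep_weight n (f y) (f y)) = 2 * (n - 1) * (\<Sum>y<a. f y) - 2 * (\<Sum>y<a. f y * (f y - 1))"
  unfolding sep_weight_def by (simp add: sum_subtractf sum_distrib_left[symmetric])

section \<open>Separation counts of the two layered orders\<close>

definition up :: "nat \<Rightarrow> nat" where "up i = i"

text \<open>Fixes 0 and exchanges 1 and 2, so the layers read A C B instead of A B C.\<close>

definition flip :: "nat \<Rightarrow> nat" where "flip i = (3 - i) mod 3"

lemma layer_order_up: "layer_order up" and layer_order_flip: "layer_order flip"
  by (auto simp: layer_order_def up_def flip_def inj_on_def)

text \<open>The types of nonincident edge pairs up to exchanging the edges, with a common part
  listed first. In the first three types both edges join the same two parts; in the last three they
  share only part \<open>i\<close> and meet all three parts.\<close>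

definition base_types :: "(nat \<times> nat \<times> nat) set" where
  "base_types = {(0, 1, 1), (0, 2, 2), (1, 2, 2), (0, 1, 2), (1, 0, 2), (2, 0, 1)}"

lemma card_offdiag_part:
  "real (card (offdiag (part m i) (part m i))) = real (part_size m i) * (real (part_size m i) - 1)"
  "i \<noteq> j \<Longrightarrow> real (card (offdiag (part m i) (part m j))) = real (part_size m i) * real (part_size m j)"
proof -
  show "real (card (offdiag (part m i) (part m i))) = real (part_size m i) * (real (part_size m i) - 1)"
    by (simp add: card_offdiag)
  assume "i \<noteq> j"
  then have "offdiag (part m i) (part m j) = part m i \<times> part m j"
    using part_disjoint[of i j m] by (auto simp: offdiag_def)
  then show "real (card (offdiag (part m i) (part m j))) = real (part_size m i) * real (part_size m j)"
    by (simp add: card_cartesian_product)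
qed

text \<open>Part 0 leads every layer in both orders, so exactly \<open>y + 1\<close> of its vertices
  precede the vertex of index \<open>y\<close> in part \<open>j\<close>.\<close>

lemma sepsum_layered_same_01:
  assumes "j = 1 \<or> j = 2" "w = up \<or> w = flip"
  shows "sepsum (layered w) (part m 0) (part m j) (part m j) = real m * ((real m)\<^sup>2 - 1) * (real m + 1) / 3"
proof -
  have w: "layer_order w" using assms(2) layer_order_up layer_order_flip by auto
  have "w 0 < w j" using assms by (auto simp: up_def flip_def)
  then have "2 * sepsum (layered w) (part m 0) (part m j) (part m j) =
    (\<Sum>y<m. \<Sum>z<m. sep_weight (real m + 1) (real y + 1) (real z + 1)) - (\<Sum>y<m. sep_weight (real m + 1) (real y + 1) (real y + 1))"
    using sepsum_layered_same[OF w, of 0 j m] assms(1) by (auto simp: part_size_def add.commute)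
  also have "\<dots> = 2 * (real m * ((real m)\<^sup>2 - 1) * (real m + 1) / 3)"
    unfolding sum_sum_sep_weight sum_sep_weight_same sum_sum_max_Suc sum_rising sum_falling sum_lessThan_real sum_lessThan_real_Suc
    by (simp add: algebra_simps power2_eq_square diff_divide_distrib add_divide_distrib)
  finally show ?thesis by linarith
qed

text \<open>Here the orders differ: the vertex of index \<open>y\<close> in part 2 has
  \<open>y + 1\<close> predecessors in part 1 under \<open>up\<close> and \<open>y\<close> under
  \<open>flip\<close>. Only the sum of both counts is needed.\<close>

lemma sepsum_layered_same_12:
  "sepsum (layered up) (part m 1) (part m 2) (part m 2) + sepsum (layered flip) (part m 1) (part m 2) (part m 2)
    = real m * (real m - 1)\<^sup>2 * (2 * real m + 2) / 3"
proof -
  have "2 * sepsum (layered up) (part m 1) (part m 2) (part m 2) =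
    (\<Sum>y<m. \<Sum>z<m. sep_weight (real m) (real y + 1) (real z + 1)) - (\<Sum>y<m. sep_weight (real m) (real y + 1) (real y + 1))"
    using sepsum_layered_same[OF layer_order_up, of 1 2 m] by (simp add: part_size_def up_def add.commute)
  moreover have "2 * sepsum (layered flip) (part m 1) (part m 2) (part m 2) =
    (\<Sum>y<m. \<Sum>z<m. sep_weight (real m) (real y) (real z)) - (\<Sum>y<m. sep_weight (real m) (real y) (real y))"
    using sepsum_layered_same[OF layer_order_flip, of 1 2 m] by (simp add: part_size_def flip_def)
  ultimately have "2 * sepsum (layered up) (part m 1) (part m 2) (part m 2) + 2 * sepsum (layered flip) (part m 1) (part m 2) (part m 2)
     = 2 * (real m * (real m - 1)\<^sup>2 * (2 * real m + 2) / 3)"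
    unfolding sum_sum_sep_weight sum_sep_weight_same sum_sum_max_Suc sum_sum_max sum_rising sum_falling sum_lessThan_real sum_lessThan_real_Suc
    by (simp add: algebra_simps power2_eq_square diff_divide_distrib add_divide_distrib)
  then show ?thesis by simp
qed

lemma sepsum_layered_012:
  assumes "w = up \<or> w = flip"
  shows "sepsum (layered w) (part m 0) (part m 1) (part m 2) = (real m)\<^sup>2 * (real m + 1) * (2 * real m + 1) / 6"
proof -
  have w: "layer_order w" using assms layer_order_up layer_order_flip by auto
  have "w 0 < w 1" "w 0 < w 2" using assms by (auto simp: up_def flip_def)
  then have "2 * sepsum (layered w) (part m 0) (part m 1) (part m 2) =
    (\<Sum>y<m. \<Sum>z<m. sep_weight (real m + 1) (real y + 1) (real z + 1))"
    using sepsum_layered_distinct[OF w, of 0 1 2 m] by (auto simp: part_size_def add.commute)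
  also have "\<dots> = 2 * ((real m)\<^sup>2 * (real m + 1) * (2 * real m + 1) / 6)"
    unfolding sum_sum_sep_weight sum_sum_max_Suc sum_rising sum_falling sum_lessThan_real sum_lessThan_real_Suc
    by (simp add: algebra_simps power2_eq_square diff_divide_distrib add_divide_distrib)
  finally show ?thesis by linarith
qed

text \<open>Part \<open>i\<close> precedes part \<open>k\<close> within the layers of exactly one of
  the two orders. The sum is therefore the same for both choices of \<open>(i, k)\<close>.\<close>

lemma sepsum_layered_102:
  assumes "(i, k) = (1, 2) \<or> (i, k) = (2, 1)"
  shows "sepsum (layered up) (part m i) (part m 0) (part m k) + sepsum (layered flip) (part m i) (part m 0) (part m k)
    = (real m + 1) * real m * (real m - 1) * (2 * real m + 1) / 3"
proof -
  let ?S = "\<lambda>w. sepsum (layered w) (part m i) (part m 0) (part m k)"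
  let ?R1 = "(\<Sum>y<m + 1. \<Sum>z<m. sep_weight (real m) (real y) (real z + 1))"
  let ?R0 = "(\<Sum>y<m + 1. \<Sum>z<m. sep_weight (real m) (real y) (real z))"
  have "2 * ?S w = (if w i < w k then ?R1 else ?R0)" if w: "layer_order w" for w
    using sepsum_layered_distinct[OF w, of i 0 k m] layer_orderD(3)[OF w] assms
    by (auto simp: part_size_def add.commute)
  from this[OF layer_order_up] this[OF layer_order_flip]
  have "2 * ?S up + 2 * ?S flip = ?R1 + ?R0"
    using assms by (auto simp: up_def flip_def)
  also have "\<dots> = 2 * ((real m + 1) * real m * (real m - 1) * (2 * real m + 1) / 3)"
    unfolding sum_sum_sep_weight sum_sum_max_rect sum_sum_max_rect_Suc sum_rising sum_falling sum_lessThan_real sum_lessThan_real_Suc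
    by (simp add: algebra_simps power2_eq_square diff_divide_distrib add_divide_distrib)
  finally show ?thesis by linarith
qed

text \<open>On average the two orders separate at least the fraction \<open>(2m + 1) / (6m)\<close>
  of the quadruples of each type. Types meeting all three parts attain equality; those joining parts
  0 and \<open>j\<close> leave the slack \<open>m^2 (m + 1) (m - 1)\<close>, and parts 1 and 2 the
  slack \<open>m^2 (m - 1)^2\<close>.\<close>

lemma sepsum_layered_types:
  assumes m: "m \<ge> 1" and type: "(i, j, k) \<in> base_types"
  shows "real (card (offdiag (part m j) (part m k))) * real (card (offdiag (part m i) (part m i))) * (2 * real m + 1)
    \<le> 3 * real m * (sepsum (layered up) (part m i) (part m j) (part m k) + sepsum (layered flip) (part m i) (part m j) (part m k))"
    (is "?L \<le> ?R")
proof -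
  let ?M = "real m"
  have card0: "real (card (offdiag (part m 0) (part m 0))) = (?M + 1) * ?M"
    unfolding card_offdiag_part(1) by (simp add: part_size_def)
  have cardS: "real (card (offdiag (part m h) (part m h))) = ?M * (?M - 1)" if "h \<noteq> 0" for h
    unfolding card_offdiag_part(1) using that by (simp add: part_size_def)
  consider (1) "i = 0" "j = 1 \<or> j = 2" "k = j" | (2) "i = 1" "j = 2" "k = 2"
    | (3) "i = 0" "j = 1" "k = 2" | (4) "(i, k) = (1, 2) \<or> (i, k) = (2, 1)" "j = 0"
    using type by (auto simp: base_types_def)
  then have "0 \<le> ?R - ?L"
  proof cases
    case 1
    then have "?R - ?L = ?M\<^sup>2 * (?M + 1) * (?M - 1)"
      unfolding 1(1,3) card0 cardS[of j] sepsum_layered_same_01[OF 1(2) disjI1[OF refl]]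
        sepsum_layered_same_01[OF 1(2) disjI2[OF refl]]
      by (auto simp: cardS algebra_simps power2_eq_square diff_divide_distrib add_divide_distrib)
    with m show ?thesis by simp
  next
    case 2
    have "?R - ?L = ?M\<^sup>2 * (?M - 1)\<^sup>2"
      unfolding 2 sepsum_layered_same_12 cardS[OF one_neq_zero] cardS[OF zero_neq_numeral[symmetric]]
      by (simp add: algebra_simps power2_eq_square diff_divide_distrib add_divide_distrib)
    then show ?thesis by simp
  next
    case 3
    have "?R - ?L = 0"
      unfolding 3 card0 sepsum_layered_012[OF disjI1[OF refl]] sepsum_layered_012[OF disjI2[OF refl]]
      by (simp add: card_offdiag_part(2) part_size_def algebra_simps power2_eq_square diff_divide_distrib add_divide_distrib)
    then show ?thesis by simp
  next
    case 4
    then have "i \<noteq> 0" "k \<noteq> 0" by auto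
    then have "?R - ?L = 0"
      unfolding 4(2) sepsum_layered_102[OF 4(1)] cardS[OF \<open>i \<noteq> 0\<close>]
      by (simp add: card_offdiag_part(2) part_size_def algebra_simps power2_eq_square diff_divide_distrib add_divide_distrib)
    then show ?thesis by simp
  qed
  then show ?thesis by simp
qed

section \<open>Linear orders and ranks\<close>

definition verts :: "nat \<Rightarrow> (nat \<times> nat) set" where
  "verts m = part m 0 \<union> part m 1 \<union> part m 2"

lemma finite_verts [simp]: "finite (verts m)"
  by (simp add: verts_def)

lemma verts_iff: "v \<in> verts m \<longleftrightarrow> fst v < 3 \<and> v \<in> part m (fst v)"
  by (cases v) (auto simp: verts_def part_def less_Suc_eq numeral_3_eq_3 numeral_2_eq_2)

lemma part_iff_verts: "i < 3 \<Longrightarrow> v \<in> part m i \<longleftrightarrow> v \<in> verts m \<and> fst v = i"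
  unfolding verts_iff by (auto simp: part_def)

lemma vertices_tripartite: "vertices (complete_tripartite (m + 1) m m) = verts m"
  by (simp add: complete_tripartite_def verts_def part_def part_size_def Let_def)

lemma edges_tripartite:
  "edges (complete_tripartite (m + 1) m m) = {{u, v} | u v. u \<in> verts m \<and> v \<in> verts m \<and> fst u \<noteq> fst v}"
  by (simp add: complete_tripartite_def verts_def part_def part_size_def Let_def)

lemma edge_tripartiteI:
  "u \<in> verts m \<Longrightarrow> v \<in> verts m \<Longrightarrow> fst u \<noteq> fst v \<Longrightarrow> {u, v} \<in> edges (complete_tripartite (m + 1) m m)"
  unfolding edges_tripartite by blast

definition order_by :: "('v \<Rightarrow> nat) \<Rightarrow> 'v set \<Rightarrow> 'v rel" where
  "order_by p V = {(u, v). u \<in> V \<and> v \<in> V \<and> p u \<le> p v}"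

definition ranks :: "('v \<Rightarrow> nat) \<Rightarrow> 'v set \<Rightarrow> 'v rel \<Rightarrow> bool" where
  "ranks p V r \<longleftrightarrow> inj_on p V \<and> (\<forall>u\<in>V. \<forall>v\<in>V. (u, v) \<in> r \<and> u \<noteq> v \<longleftrightarrow> p u < p v)"

lemma linear_order_on_order_by: "inj_on p V \<Longrightarrow> linear_order_on V (order_by p V)"
  by (auto simp: order_by_def linear_order_on_def partial_order_on_def preorder_on_def refl_on_def trans_def
      antisym_def total_on_def inj_on_def)

lemma ranks_order_by: "inj_on p V \<Longrightarrow> ranks p V (order_by p V)"
  by (auto simp: ranks_def order_by_def inj_on_def order.strict_iff_order)

text \<open>The number of strict predecessors is a rank: the predecessor set of \<open>u\<close> is
  properly contained in that of any later \<open>v\<close>.\<close>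

lemma ex_ranks:
  assumes "finite V" "linear_order_on V r"
  shows "\<exists>p. ranks p V r"
proof -
  let ?p = "\<lambda>v. card {u \<in> V. (u, v) \<in> r \<and> u \<noteq> v}"
  have r: "trans r" "antisym r" "total_on V r"
    using assms(2) by (auto simp: linear_order_on_def partial_order_on_def preorder_on_def)
  have mono: "?p u < ?p v" if "u \<in> V" "(u, v) \<in> r" "u \<noteq> v" for u v
  proof (rule psubset_card_mono)
    show "{w \<in> V. (w, u) \<in> r \<and> w \<noteq> u} \<subset> {w \<in> V. (w, v) \<in> r \<and> w \<noteq> v}"
      using that transD[OF r(1)] antisymD[OF r(2)] by blast
  qed (use assms(1) in simp)
  have tot: "(u, v) \<in> r \<or> (v, u) \<in> r" if "u \<in> V" "v \<in> V" "u \<noteq> v" for u v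
    using r(3) that by (auto simp: total_on_def)
  have "inj_on ?p V"
  proof (rule inj_onI, rule ccontr)
    fix u v assume uv: "u \<in> V" "v \<in> V" "?p u = ?p v" "u \<noteq> v"
    then show False using tot[OF uv(1,2,4)] mono[of u v] mono[of v u] by auto
  qed
  moreover have "(u, v) \<in> r \<and> u \<noteq> v \<longleftrightarrow> ?p u < ?p v" if uv: "u \<in> V" "v \<in> V" for u v
  proof
    assume lt: "?p u < ?p v"
    then have "u \<noteq> v" by auto
    with lt tot[OF uv] mono[OF uv(2), of u] show "(u, v) \<in> r \<and> u \<noteq> v" by auto
  qed (use mono uv in blast)
  ultimately have "ranks ?p V r" unfolding ranks_def by blast
  then show ?thesis by blast
qed

lemma separates_iff_rank_sep:
  assumes "ranks p V r" "u \<in> V" "v \<in> V" "u' \<in> V" "v' \<in> V"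
  shows "separates r {u, v} {u', v'} \<longleftrightarrow> rank_sep p u v u' v'"
  using assms by (auto simp: separates_def all_precede_def rank_sep_def ranks_def)

text \<open>The quadruple \<open>((y, z), (x, x'))\<close> stands for the pair of edges \<open>{x, y}\<close> and \<open>{x', z}\<close>,
  where \<open>x\<close> and \<open>x'\<close> lie in part \<open>i\<close>, \<open>y\<close> in part \<open>j\<close> and \<open>z\<close> in part \<open>k\<close>. Any two edges of a
  tripartite graph meet a common part, so all pairs of edges are of this form.\<close>

definition quads :: "nat \<Rightarrow> nat \<Rightarrow> nat \<Rightarrow> nat \<Rightarrow> (((nat \<times> nat) \<times> (nat \<times> nat)) \<times> ((nat \<times> nat) \<times> (nat \<times> nat))) set" where
  "quads m i j k = offdiag (part m j) (part m k) \<times> offdiag (part m i) (part m i)"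

lemma quads_iff:
  assumes "i < 3" "j < 3" "k < 3"
  shows "((y, z), (x, x')) \<in> quads m i j k \<longleftrightarrow> {x, x', y, z} \<subseteq> verts m \<and> fst x = i \<and> fst x' = i \<and> fst y = j \<and> fst z = k
    \<and> x \<noteq> x' \<and> y \<noteq> z"
  using assms by (auto simp: quads_def offdiag_def part_iff_verts)

lemma sepsum_quads: "sepsum p (part m i) (part m j) (part m k) =
    (\<Sum>((y, z), (x, x'))\<in>quads m i j k. of_bool (rank_sep p x y x' z))"
  unfolding sepsum_def quads_def split_def by (simp only: sum.cartesian_product split_def)

lemma sepsum_ranks:
  assumes "ranks p (verts m) r" "i < 3" "j < 3" "k < 3"
  shows "sepsum p (part m i) (part m j) (part m k) =
    (\<Sum>((y, z), (x, x'))\<in>quads m i j k. of_bool (separates r {x, y} {x', z}))"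
  unfolding sepsum_quads
proof (rule sum.cong[OF refl], clarify)
  fix a b c d e f g h
  assume "(((a, b), (c, d)), ((e, f), (g, h))) \<in> quads m i j k"
  then have "{(e, f), (g, h), (a, b), (c, d)} \<subseteq> verts m"
    unfolding quads_iff[OF assms(2-4)] by (rule conjunct1)
  then show "of_bool (rank_sep p (e, f) (a, b) (g, h) (c, d)) = (of_bool (separates r {(e, f), (a, b)} {(g, h), (c, d)}) :: real)"
    using separates_iff_rank_sep[OF assms(1)] by simp
qed

lemma finite_quads [simp]: "finite (quads m i j k)"
  by (simp add: quads_def)

lemma quads_edges:
  assumes "((y, z), (x, x')) \<in> quads m i j k" "i < 3" "j < 3" "k < 3" "i \<noteq> j" "i \<noteq> k"
  shows "{x, y} \<in> edges (complete_tripartite (m + 1) m m)" "{x', z} \<in> edges (complete_tripartite (m + 1) m m)"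
    "nonincident {x, y} {x', z}"
proof -
  have q: "{x, x', y, z} \<subseteq> verts m" "fst x = i" "fst x' = i" "fst y = j" "fst z = k" "x \<noteq> x'" "y \<noteq> z"
    using assms(1) unfolding quads_iff[OF assms(2-4)] by auto
  show "{x, y} \<in> edges (complete_tripartite (m + 1) m m)" "{x', z} \<in> edges (complete_tripartite (m + 1) m m)"
    using q assms(5,6) by (intro edge_tripartiteI; simp)+
  show "nonincident {x, y} {x', z}" using q assms(5,6) by (auto simp: nonincident_def)
qed

section \<open>Lower bound on the length of a separating list\<close>

text \<open>Double counting of orders against the quadruples meeting all three parts. Each quadruple
  is separated at least \<open>t\<close> times, and \<open>sepsum_tripartite_le\<close> bounds what
  a single order separates.\<close>

lemma separating_list_length_ge:
  assumes m: "m \<ge> 1" and L: "separating_list (complete_tripartite (m + 1) m m) t L"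
  shows "6 * real m * real t \<le> (2 * real m + 1) * real (length L)"
proof -
  let ?G = "complete_tripartite (m + 1) m m"
  let ?M = "real m"
  have lin: "linear_order_on (verts m) r" if "r \<in> set L" for r
    using L that unfolding separating_list_def vertices_tripartite by blast
  define P where "P r = (SOME p. ranks p (verts m) r)" for r
  have P: "ranks (P r) (verts m) r" if "r \<in> set L" for r
    unfolding P_def using ex_ranks[OF finite_verts lin[OF that]] by (rule someI_ex)
  have type: "real t * real (card (quads m i j k)) \<le> (\<Sum>l<length L. sepsum (P (L ! l)) (part m i) (part m j) (part m k))"
    if ijk: "i < 3" "j < 3" "k < 3" "i \<noteq> j" "i \<noteq> k" for i j k
  proof -
    have "real t * real (card (quads m i j k)) = (\<Sum>q\<in>quads m i j k. real t)" by simp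
    also have "\<dots> \<le> (\<Sum>((y, z), (x, x'))\<in>quads m i j k. \<Sum>l<length L. of_bool (separates (L ! l) {x, y} {x', z}))"
    proof (rule sum_mono, clarify)
      fix a b c d e f g h
      assume q: "(((a, b), (c, d)), ((e, f), (g, h))) \<in> quads m i j k"
      have "t \<le> card {l. l < length L \<and> separates (L ! l) {(e, f), (a, b)} {(g, h), (c, d)}}"
        using L quads_edges[OF q ijk] unfolding separating_list_def by blast
      also have "\<dots> = card ({..<length L} \<inter> {l. separates (L ! l) {(e, f), (a, b)} {(g, h), (c, d)}})"
        by (rule arg_cong[where f = card]) auto
      finally show "real t \<le> (\<Sum>l<length L. of_bool (separates (L ! l) {(e, f), (a, b)} {(g, h), (c, d)}))"
        by simp
    qed
    also have "\<dots> = (\<Sum>l<length L. \<Sum>((y, z), (x, x'))\<in>quads m i j k. of_bool (separates (L ! l) {x, y} {x', z}))"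
      unfolding split_def by (rule sum.swap)
    also have "\<dots> = (\<Sum>l<length L. sepsum (P (L ! l)) (part m i) (part m j) (part m k))"
      by (intro sum.cong refl sepsum_ranks[OF P, symmetric] ijk nth_mem) simp
    finally show ?thesis .
  qed
  have "real t * (real (card (quads m 0 1 2)) + real (card (quads m 1 0 2)) + real (card (quads m 2 0 1)))
    \<le> (\<Sum>l<length L. sepsum (P (L ! l)) (part m 0) (part m 1) (part m 2) + sepsum (P (L ! l)) (part m 1) (part m 0) (part m 2)
       + sepsum (P (L ! l)) (part m 2) (part m 0) (part m 1))"
    unfolding sum.distrib distrib_left by (intro add_mono type) simp_all
  also have "\<dots> \<le> (\<Sum>l<length L. ?M * (?M + 1) * (3 * ?M - 2) * (2 * ?M + 1) / 6)"
  proof (intro sum_mono sepsum_tripartite_le)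
    fix l assume "l \<in> {..<length L}"
    then show "inj_on (P (L ! l)) (part m 0 \<union> part m 1 \<union> part m 2)"
      using P[of "L ! l"] by (simp add: ranks_def verts_def)
  qed (simp_all add: part_disjoint part_size_def)
  also have "real (card (quads m 0 1 2)) + real (card (quads m 1 0 2)) + real (card (quads m 2 0 1))
     = (?M * (?M + 1) * (3 * ?M - 2)) * ?M"
    unfolding quads_def card_cartesian_product of_nat_mult card_offdiag_part
    by (simp add: card_offdiag_part(2) part_size_def algebra_simps)
  finally have "(?M * (?M + 1) * (3 * ?M - 2)) * (6 * ?M * real t) \<le> (?M * (?M + 1) * (3 * ?M - 2)) * ((2 * ?M + 1) * real (length L))"
    by (simp add: algebra_simps)
  \<comment> \<open>The number of quadruples is \<open>m\<close> times this factor, which also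
    occurs in the bound for one order; being positive, it cancels.\<close>
  moreover have "?M * (?M + 1) * (3 * ?M - 2) > 0" using m by (intro mult_pos_pos) auto
  ultimately show ?thesis by (simp only: mult_le_cancel_left_pos)
qed

section \<open>Averaging over part-preserving permutations\<close>

definition part_perms :: "nat \<Rightarrow> (nat \<times> nat \<Rightarrow> nat \<times> nat) set" where
  "part_perms m = {\<sigma>. \<sigma> permutes verts m \<and> (\<forall>v. fst (\<sigma> v) = fst v)}"

lemma finite_part_perms [simp]: "finite (part_perms m)"
  unfolding part_perms_def by (rule finite_subset[OF _ finite_permutations[OF finite_verts]]) auto

lemma id_part_perms: "id \<in> part_perms m"
  by (simp add: part_perms_def permutes_id)

lemma comp_part_perms: "\<sigma> \<in> part_perms m \<Longrightarrow> \<tau> \<in> part_perms m \<Longrightarrow> \<sigma> \<circ> \<tau> \<in> part_perms m"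
  by (auto simp: part_perms_def split_paired_all intro!: permutes_compose simp del: split_paired_All)

lemma inv_part_perms:
  assumes "\<sigma> \<in> part_perms m"
  shows "inv \<sigma> \<in> part_perms m"
proof -
  have \<sigma>: "\<sigma> permutes verts m" "\<And>v. fst (\<sigma> v) = fst v" using assms by (auto simp: part_perms_def)
  have "fst (inv \<sigma> v) = fst v" for v
    using \<sigma>(2)[of "inv \<sigma> v"] permutes_inverses(1)[OF \<sigma>(1)] by simp
  with permutes_inv[OF \<sigma>(1)] show ?thesis by (simp add: part_perms_def)
qed

lemma bij_betw_comp_part_perms:
  assumes "\<tau> \<in> part_perms m"
  shows "bij_betw (\<lambda>\<sigma>. \<sigma> \<circ> \<tau>) (part_perms m) (part_perms m)"
proof (rule bij_betwI[where g = "\<lambda>\<sigma>. \<sigma> \<circ> inv \<tau>"])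
  have "\<tau> permutes verts m" using assms by (simp add: part_perms_def)
  then show "\<sigma> \<circ> \<tau> \<circ> inv \<tau> = \<sigma>" "\<sigma> \<circ> inv \<tau> \<circ> \<tau> = \<sigma>" for \<sigma> :: "nat \<times> nat \<Rightarrow> nat \<times> nat"
    by (simp_all add: comp_assoc permutes_inv_o)
qed (use assms in \<open>auto intro!: comp_part_perms inv_part_perms\<close>)

lemma transpose_part_perms:
  assumes "u \<in> verts m" "v \<in> verts m" "fst u = fst v"
  shows "transpose u v \<in> part_perms m"
proof -
  have "fst (transpose u v w) = fst w" for w
    using assms(3) by (simp add: transpose_def)
  with permutes_swap_id[OF assms(1,2)] show ?thesis unfolding part_perms_def by blast
qed

text \<open>Induction on the lists: once \<sigma> maps the tails correctly, it is followed by the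
  transposition of \<open>\<sigma> u\<close> and \<open>v\<close>. Neither of these lies in the tail
  \<open>vs\<close>, so the tail stays in place.\<close>

lemma part_perms_transitive:
  assumes "length us = length vs" "distinct us" "distinct vs" "set us \<subseteq> verts m" "set vs \<subseteq> verts m" "map fst us = map fst vs"
  shows "\<exists>\<sigma>\<in>part_perms m. map \<sigma> us = vs"
  using assms
proof (induction us vs rule: list_induct2)
  case Nil
  show ?case using id_part_perms by auto
next
  case (Cons u us v vs)
  then obtain \<sigma> where \<sigma>: "\<sigma> \<in> part_perms m" "map \<sigma> us = vs" by auto
  then have perm: "\<sigma> permutes verts m" and fst: "\<And>w. fst (\<sigma> w) = fst w" by (auto simp: part_perms_def)
  have "\<sigma> u \<notin> \<sigma> ` set us"
    using Cons.prems(1) by (simp add: inj_image_mem_iff[OF permutes_inj[OF perm]])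
  then have "\<sigma> u \<notin> set vs" using \<sigma>(2) by auto
  moreover have "v \<notin> set vs" using Cons.prems by simp
  ultimately have fixed: "transpose (\<sigma> u) v w = w" if "w \<in> set vs" for w
    using that by (auto simp: transpose_def)
  have "\<sigma> u \<in> verts m" using permutes_in_image[OF perm, of u] Cons.prems by simp
  then have "transpose (\<sigma> u) v \<in> part_perms m"
    using Cons.prems fst by (intro transpose_part_perms) auto
  then have "transpose (\<sigma> u) v \<circ> \<sigma> \<in> part_perms m" using comp_part_perms \<sigma>(1) by blast
  moreover have "map (transpose (\<sigma> u) v \<circ> \<sigma>) (u # us) = v # vs"
    using fixed unfolding \<sigma>(2)[symmetric] by simp
  ultimately show ?case by (intro bexI[of _ "transpose (\<sigma> u) v \<circ> \<sigma>"])
qed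

section \<open>The action on quadruples and averaging\<close>

definition act :: "('v \<Rightarrow> 'v) \<Rightarrow> ('v \<times> 'v) \<times> ('v \<times> 'v) \<Rightarrow> ('v \<times> 'v) \<times> ('v \<times> 'v)" where
  "act \<sigma> = map_prod (map_prod \<sigma> \<sigma>) (map_prod \<sigma> \<sigma>)"

lemma act_comp: "act \<sigma> (act \<tau> q) = act (\<sigma> \<circ> \<tau>) q"
  by (simp add: act_def map_prod_def split_def)

lemma act_quads:
  assumes "\<sigma> \<in> part_perms m" "q \<in> quads m i j k" and ijk: "i < 3" "j < 3" "k < 3"
  shows "act \<sigma> q \<in> quads m i j k"
proof -
  obtain y z x x' where q: "q = ((y, z), (x, x'))" by (metis surj_pair)
  have \<sigma>: "\<sigma> permutes verts m" "\<And>v. fst (\<sigma> v) = fst v" using assms by (auto simp: part_perms_def)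
  show ?thesis
    using assms(2) unfolding q act_def map_prod_simp quads_iff[OF ijk]
    by (simp add: \<sigma>(2) permutes_in_image[OF \<sigma>(1)] inj_eq[OF permutes_inj[OF \<sigma>(1)]])
qed

lemma bij_betw_act_quads:
  assumes "\<sigma> \<in> part_perms m" and ijk: "i < 3" "j < 3" "k < 3"
  shows "bij_betw (act \<sigma>) (quads m i j k) (quads m i j k)"
proof (rule bij_betwI[where g = "act (inv \<sigma>)"])
  have "\<sigma> permutes verts m" using assms by (simp add: part_perms_def)
  then show "act (inv \<sigma>) (act \<sigma> q) = q" "act \<sigma> (act (inv \<sigma>) q) = q" for q
    unfolding act_comp by (simp_all add: permutes_inv_o act_def prod.map_id0)
qed (use assms in \<open>auto intro!: act_quads inv_part_perms\<close>)

lemma act_transitive: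
  assumes "q \<in> quads m i j k" "q' \<in> quads m i j k" and ijk: "i < 3" "j < 3" "k < 3" "i \<noteq> j" "i \<noteq> k"
  shows "\<exists>\<sigma>\<in>part_perms m. act \<sigma> q = q'"
proof -
  obtain y z x x' where q: "q = ((y, z), (x, x'))" by (metis surj_pair)
  obtain y1 z1 x1 x1' where q': "q' = ((y1, z1), (x1, x1'))" by (metis surj_pair)
  have "\<exists>\<sigma>\<in>part_perms m. map \<sigma> [x, x', y, z] = [x1, x1', y1, z1]"
    using assms(1,2,6,7) unfolding q q' quads_iff[OF ijk(1-3)]
    by (intro part_perms_transitive) auto
  then show ?thesis by (auto simp: q q' act_def)
qed

text \<open>The sum of \<open>h\<close> along the orbit of \<open>q\<close> does not depend on
  \<open>q\<close>, by transitivity and right translation in the group. Summing it over all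
  quadruples and exchanging the sums gives the claim, since each \<open>act \<sigma>\<close>
  permutes the quadruples.\<close>

lemma average_over_part_perms:
  fixes h :: "_ \<Rightarrow> real"
  assumes q: "q \<in> quads m i j k" and ijk: "i < 3" "j < 3" "k < 3" "i \<noteq> j" "i \<noteq> k"
  shows "real (card (quads m i j k)) * (\<Sum>\<sigma>\<in>part_perms m. h (act \<sigma> q))
    = real (card (part_perms m)) * (\<Sum>q\<in>quads m i j k. h q)"
proof -
  let ?F = "\<lambda>q. \<Sum>\<sigma>\<in>part_perms m. h (act \<sigma> q)"
  have const: "?F q' = ?F q" if q': "q' \<in> quads m i j k" for q'
  proof -
    obtain \<tau> where \<tau>: "\<tau> \<in> part_perms m" "act \<tau> q = q'" using act_transitive[OF q q' ijk] by blast
    have "?F q' = (\<Sum>\<sigma>\<in>part_perms m. h (act (\<sigma> \<circ> \<tau>) q))" unfolding \<tau>(2)[symmetric] act_comp ..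
    also have "\<dots> = ?F q" by (rule sum.reindex_bij_betw[OF bij_betw_comp_part_perms[OF \<tau>(1)]])
    finally show ?thesis .
  qed
  have "real (card (quads m i j k)) * ?F q = (\<Sum>q'\<in>quads m i j k. ?F q')"
    by (simp add: const)
  also have "\<dots> = (\<Sum>\<sigma>\<in>part_perms m. \<Sum>q'\<in>quads m i j k. h (act \<sigma> q'))" by (rule sum.swap)
  also have "\<dots> = (\<Sum>\<sigma>\<in>part_perms m. \<Sum>q'\<in>quads m i j k. h q')"
    by (intro sum.cong refl sum.reindex_bij_betw bij_betw_act_quads ijk)
  finally show ?thesis by simp
qed

text \<open>Permuting the order amounts to moving the quadruple:
  \<open>layered w \<circ> \<sigma>\<close> separates it exactly if \<open>layered w\<close>
  separates its image under \<open>act \<sigma>\<close>. The average over a type from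
  \<open>sepsum_layered_types\<close> thus holds for every single quadruple.\<close>

lemma part_perms_separations:
  assumes m: "m \<ge> 1" and type: "(i, j, k) \<in> base_types" and q: "((y, z), (x, x')) \<in> quads m i j k"
  shows "real (card (part_perms m)) * (2 * real m + 1) \<le> 3 * real m *
    (\<Sum>\<sigma>\<in>part_perms m. of_bool (rank_sep (layered up \<circ> \<sigma>) x y x' z) + of_bool (rank_sep (layered flip \<circ> \<sigma>) x y x' z))"
proof -
  have ijk: "i < 3" "j < 3" "k < 3" "i \<noteq> j" "i \<noteq> k" using type by (auto simp: base_types_def)
  define h where "h = (\<lambda>((y, z), (x, x')). of_bool (rank_sep (layered up) x y x' z) + of_bool (rank_sep (layered flip) x y x' z) :: real)"
  let ?F = "\<Sum>\<sigma>\<in>part_perms m. h (act \<sigma> ((y, z), (x, x')))"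
  have F: "?F = (\<Sum>\<sigma>\<in>part_perms m. of_bool (rank_sep (layered up \<circ> \<sigma>) x y x' z) + of_bool (rank_sep (layered flip \<circ> \<sigma>) x y x' z))"
    by (simp add: h_def act_def rank_sep_def)
  let ?c = "real (card (quads m i j k))"
  have "(\<Sum>q\<in>quads m i j k. h q) = sepsum (layered up) (part m i) (part m j) (part m k) + sepsum (layered flip) (part m i) (part m j) (part m k)"
    unfolding sepsum_quads sum.distrib[symmetric] h_def by (rule sum.cong) auto
  then have "?c * (2 * real m + 1) \<le> 3 * real m * (\<Sum>q\<in>quads m i j k. h q)"
    using sepsum_layered_types[OF m type] unfolding quads_def card_cartesian_product by simp
  then have "real (card (part_perms m)) * (?c * (2 * real m + 1)) \<le> real (card (part_perms m)) * (3 * real m * (\<Sum>q\<in>quads m i j k. h q))"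
    by (rule mult_left_mono) simp
  also have "\<dots> = 3 * real m * (real (card (part_perms m)) * (\<Sum>q\<in>quads m i j k. h q))" by simp
  also have "\<dots> = 3 * real m * (?c * ?F)"
    unfolding average_over_part_perms[OF q ijk] ..
  finally have "?c * (real (card (part_perms m)) * (2 * real m + 1)) \<le> ?c * (3 * real m * ?F)"
    by (simp only: mult_ac)
  moreover have "?c > 0" using q by (auto simp: card_gt_0_iff)
  ultimately show ?thesis unfolding F by (simp only: mult_le_cancel_left_pos)
qed

text \<open>With the endpoints of each edge sorted by part, two edges must share a part, as there
  are only three. That part becomes \<open>i\<close>, and the edges are exchanged where needed to
  reach a listed type.\<close>

lemma nonincident_edges_quads:
  assumes "e \<in> edges (complete_tripartite (m + 1) m m)" "f \<in> edges (complete_tripartite (m + 1) m m)" "nonincident e f"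
  shows "\<exists>i j k x x' y z. (i, j, k) \<in> base_types \<and> ((y, z), (x, x')) \<in> quads m i j k \<and>
    (e = {x, y} \<and> f = {x', z} \<or> f = {x, y} \<and> e = {x', z})"
proof -
  have ordered: "\<exists>u v. u \<in> verts m \<and> v \<in> verts m \<and> e = {u, v} \<and> (fst u, fst v) \<in> {(0, 1), (0, 2), (1, 2)}"
    if e: "e \<in> edges (complete_tripartite (m + 1) m m)" for e
  proof -
    obtain u v where uv: "u \<in> verts m" "v \<in> verts m" "e = {u, v}" "fst u \<noteq> fst v"
      using e unfolding edges_tripartite by blast
    have three: "fst w = 0 \<or> fst w = 1 \<or> fst w = 2" if "w \<in> verts m" for w
      using that unfolding verts_def part_def by auto
    have "e = {v, u}" using uv by auto
    consider "(fst u, fst v) \<in> {(0, 1), (0, 2), (1, 2)}" | "(fst v, fst u) \<in> {(0, 1), (0, 2), (1, 2)}"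
      using uv(4) three[OF uv(1)] three[OF uv(2)] by auto
    then show ?thesis using uv(1-3) \<open>e = {v, u}\<close> by (cases; blast)
  qed
  obtain a b where e: "a \<in> verts m" "b \<in> verts m" "e = {a, b}" "(fst a, fst b) \<in> {(0, 1), (0, 2), (1, 2)}"
    using ordered[OF assms(1)] by blast
  obtain c d where f: "c \<in> verts m" "d \<in> verts m" "f = {c, d}" "(fst c, fst d) \<in> {(0, 1), (0, 2), (1, 2)}"
    using ordered[OF assms(2)] by blast
  have neq: "a \<noteq> c" "a \<noteq> d" "b \<noteq> c" "b \<noteq> d" using assms(3) by (auto simp: nonincident_def e(3) f(3))
  have witness: ?thesis
    if "(fst x, fst y, fst z) \<in> base_types" "{x, x', y, z} \<subseteq> verts m" "fst x' = fst x" "x \<noteq> x'" "y \<noteq> z"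
      "e = {x, y} \<and> f = {x', z} \<or> f = {x, y} \<and> e = {x', z}" for x x' y z
  proof -
    have "fst x < 3" "fst y < 3" "fst z < 3" using that(1) by (auto simp: base_types_def)
    then have "((y, z), (x, x')) \<in> quads m (fst x) (fst y) (fst z)" using that(2-5) by (subst quads_iff) auto
    then show ?thesis using that(1,6) by blast
  qed
  have "fst a = fst c \<or> fst b = fst c \<or> fst a = fst d \<or> fst b = fst d"
    using e(4) f(4) by auto
  \<comment> \<open>Edges joining the same two parts fall under the first two cases, so a common
    last part alone leaves only strict inequalities between the other two parts.\<close>
  then consider (1) "fst a = fst c" "fst b \<le> fst d" | (2) "fst a = fst c" "fst d \<le> fst b"
    | (3) "fst b = fst c" | (4) "fst a = fst d" | (5) "fst b = fst d" "fst a < fst c" | (6) "fst b = fst d" "fst c < fst a"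
    using le_cases[of "fst b" "fst d"] less_linear[of "fst a" "fst c"] by blast
  then show ?thesis
  proof cases
    case 1
    show ?thesis
    proof (rule witness[of a b d c])
      show "(fst a, fst b, fst d) \<in> base_types"
        using 1 e(4) f(4) unfolding base_types_def insert_iff empty_iff prod.inject by presburger
      show "e = {a, b} \<and> f = {c, d} \<or> f = {a, b} \<and> e = {c, d}"
        unfolding e(3) f(3) by blast
      show "{a, c, b, d} \<subseteq> verts m" using e(1,2) f(1,2) by blast
      show "fst c = fst a" using 1 by argo
    qed (use neq in blast)+
  next
    case 2
    show ?thesis
    proof (rule witness[of c d b a])
      show "(fst c, fst d, fst b) \<in> base_types"
        using 2 e(4) f(4) unfolding base_types_def insert_iff empty_iff prod.inject by presburger
      show "e = {c, d} \<and> f = {a, b} \<or> f = {c, d} \<and> e = {a, b}"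
        unfolding e(3) f(3) by blast
      show "{c, a, d, b} \<subseteq> verts m" using e(1,2) f(1,2) by blast
      show "fst a = fst c" using 2 by argo
    qed (use neq in blast)+
  next
    case 3
    show ?thesis
    proof (rule witness[of b a d c])
      show "(fst b, fst a, fst d) \<in> base_types"
        using 3 e(4) f(4) unfolding base_types_def insert_iff empty_iff prod.inject by presburger
      show "e = {b, a} \<and> f = {c, d} \<or> f = {b, a} \<and> e = {c, d}"
        unfolding e(3) f(3) by blast
      show "{b, c, a, d} \<subseteq> verts m" using e(1,2) f(1,2) by blast
      show "fst c = fst b" using 3 by argo
    qed (use neq in blast)+
  next
    case 4
    show ?thesis
    proof (rule witness[of d c b a])
      show "(fst d, fst c, fst b) \<in> base_types"
        using 4 e(4) f(4) unfolding base_types_def insert_iff empty_iff prod.inject by presburger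
      show "e = {d, c} \<and> f = {a, b} \<or> f = {d, c} \<and> e = {a, b}"
        unfolding e(3) f(3) by blast
      show "{d, a, c, b} \<subseteq> verts m" using e(1,2) f(1,2) by blast
      show "fst a = fst d" using 4 by argo
    qed (use neq in blast)+
  next
    case 5
    show ?thesis
    proof (rule witness[of b a c d])
      show "(fst b, fst a, fst c) \<in> base_types"
        using 5 e(4) f(4) unfolding base_types_def insert_iff empty_iff prod.inject by presburger
      show "e = {b, a} \<and> f = {d, c} \<or> f = {b, a} \<and> e = {d, c}"
        unfolding e(3) f(3) by blast
      show "{b, d, a, c} \<subseteq> verts m" using e(1,2) f(1,2) by blast
      show "fst d = fst b" using 5 by argo
    qed (use neq in blast)+
  next
    case 6
    show ?thesis
    proof (rule witness[of d c a b])
      show "(fst d, fst c, fst a) \<in> base_types"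
        using 6 e(4) f(4) unfolding base_types_def insert_iff empty_iff prod.inject by presburger
      show "e = {d, c} \<and> f = {b, a} \<or> f = {d, c} \<and> e = {b, a}"
        unfolding e(3) f(3) by blast
      show "{d, b, c, a} \<subseteq> verts m" using e(1,2) f(1,2) by blast
      show "fst b = fst d" using 6 by argo
    qed (use neq in blast)+
  qed
qed

section \<open>Separating lists\<close>

text \<open>Counting by \<open>filter\<close> makes the number of separations additive under
  concatenation of lists.\<close>

lemma separating_list_iff_filter:
  "separating_list G t L \<longleftrightarrow> (\<forall>r\<in>set L. linear_order_on (vertices G) r) \<and>
    (\<forall>e\<in>edges G. \<forall>f\<in>edges G. nonincident e f \<longrightarrow> t \<le> length (filter (\<lambda>r. separates r e f) L))"
  by (simp add: separating_list_def length_filter_conv_card)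

lemma separating_list_mono: "separating_list G t L \<Longrightarrow> s \<le> t \<Longrightarrow> separating_list G s L"
  unfolding separating_list_def using le_trans by blast

lemma length_filter_concat_replicate:
  "length (filter P (concat (replicate n L))) = n * length (filter P L)"
  by (induction n) auto

lemma separates_commute: "separates r e f \<longleftrightarrow> separates r f e"
  by (auto simp: separates_def)

lemma inj_on_layered_perm:
  assumes "layer_order w" "\<sigma> \<in> part_perms m"
  shows "inj_on (layered w \<circ> \<sigma>) (verts m)"
proof (rule comp_inj_on)
  have \<sigma>: "\<sigma> permutes verts m" using assms(2) by (simp add: part_perms_def)
  then show "inj_on \<sigma> (verts m)" by (rule permutes_inj_on)
  have "verts m \<subseteq> {..<3} \<times> UNIV" by (auto simp: verts_def part_def)
  then show "inj_on (layered w) (\<sigma> ` verts m)"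
    unfolding permutes_image[OF \<sigma>] by (rule inj_on_subset[OF inj_on_layered[OF assms(1)]])
qed

text \<open>The list consists of all part-preserving rearrangements of both layered orders. The
  frequency \<open>(2m + 1) / (6m)\<close> is stated with denominators cleared, so that it stays in
  the naturals.\<close>

lemma ex_base_list:
  assumes m: "m \<ge> 1"
  shows "\<exists>L. length L = 2 * card (part_perms m) \<and>
    (\<forall>r\<in>set L. linear_order_on (verts m) r) \<and>
    (\<forall>e\<in>edges (complete_tripartite (m + 1) m m). \<forall>f\<in>edges (complete_tripartite (m + 1) m m). nonincident e f \<longrightarrow>
      card (part_perms m) * (2 * m + 1) \<le> 3 * m * length (filter (\<lambda>r. separates r e f) L))"
proof -
  let ?ord = "\<lambda>w \<sigma>. order_by (layered w \<circ> \<sigma>) (verts m)"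
  obtain \<sigma>s where \<sigma>s: "set \<sigma>s = part_perms m" "distinct \<sigma>s"
    using finite_distinct_list[OF finite_part_perms] by blast
  let ?L = "map (?ord up) \<sigma>s @ map (?ord flip) \<sigma>s"
  have len: "length ?L = 2 * card (part_perms m)"
    using distinct_card[OF \<sigma>s(2)] \<sigma>s(1) by simp
  have lin: "linear_order_on (verts m) r" if "r \<in> set ?L" for r
    using that by (auto simp: \<sigma>s(1) intro!: linear_order_on_order_by inj_on_layered_perm layer_order_up layer_order_flip)
  have count: "card (part_perms m) * (2 * m + 1) \<le> 3 * m * length (filter (\<lambda>r. separates r {x, y} {x', z}) ?L)"
    if type: "(i, j, k) \<in> base_types" and q: "((y, z), (x, x')) \<in> quads m i j k" for i j k x y z x'
  proof -
    have "i < 3" "j < 3" "k < 3" using type by (auto simp: base_types_def)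
    then have V: "x \<in> verts m" "y \<in> verts m" "x' \<in> verts m" "z \<in> verts m" using q by (auto simp: quads_iff)
    have *: "real (length (filter (\<lambda>r. separates r {x, y} {x', z}) (map (?ord w) \<sigma>s)))
      = (\<Sum>\<sigma>\<in>part_perms m. of_bool (rank_sep (layered w \<circ> \<sigma>) x y x' z))" if w: "layer_order w" for w
    proof -
      have "length (filter (\<lambda>r. separates r {x, y} {x', z}) (map (?ord w) \<sigma>s))
        = card ({\<sigma>. separates (?ord w \<sigma>) {x, y} {x', z}} \<inter> part_perms m)"
        using distinct_length_filter[OF \<sigma>s(2)] \<sigma>s(1) by (simp add: filter_map comp_def)
      also have "{\<sigma>. separates (?ord w \<sigma>) {x, y} {x', z}} \<inter> part_perms m
         = part_perms m \<inter> {\<sigma>. rank_sep (layered w \<circ> \<sigma>) x y x' z}"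
        using separates_iff_rank_sep[OF ranks_order_by[OF inj_on_layered_perm[OF w]] V] by blast
      finally have eq: "length (filter (\<lambda>r. separates r {x, y} {x', z}) (map (?ord w) \<sigma>s))
        = card (part_perms m \<inter> {\<sigma>. rank_sep (layered w \<circ> \<sigma>) x y x' z})" .
      show ?thesis unfolding eq by simp
    qed
    have "real (card (part_perms m) * (2 * m + 1)) \<le> real (3 * m * length (filter (\<lambda>r. separates r {x, y} {x', z}) ?L))"
      using part_perms_separations[OF m type q]
      unfolding sum.distrib *[OF layer_order_up, symmetric] *[OF layer_order_flip, symmetric]
      by (simp only: filter_append length_append of_nat_mult of_nat_add of_nat_numeral of_nat_1)
    then show ?thesis by (simp only: of_nat_le_iff)
  qed
  have "card (part_perms m) * (2 * m + 1) \<le> 3 * m * length (filter (\<lambda>r. separates r e f) ?L)"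
    if edges: "e \<in> edges (complete_tripartite (m + 1) m m)" "f \<in> edges (complete_tripartite (m + 1) m m)" "nonincident e f" for e f
  proof -
    obtain i j k x x' y z where q: "(i, j, k) \<in> base_types" "((y, z), (x, x')) \<in> quads m i j k"
      and ef: "e = {x, y} \<and> f = {x', z} \<or> f = {x, y} \<and> e = {x', z}"
      using nonincident_edges_quads[OF edges] by blast
    have "(\<lambda>r. separates r e f) = (\<lambda>r. separates r {x, y} {x', z})"
      using ef separates_commute[of _ "{x, y}" "{x', z}"] by auto
    then show ?thesis using count[OF q] by simp
  qed
  with len lin show ?thesis by blast
qed

text \<open>Repeating the base list \<open>3mn\<close> times absorbs the factor \<open>3m\<close> in
  its separation bound.\<close>

lemma ex_separating_list:
  assumes m: "m \<ge> 1"
  shows "\<exists>L. separating_list (complete_tripartite (m + 1) m m) (n * card (part_perms m) * (2 * m + 1)) L \<and>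
    length L = n * card (part_perms m) * (6 * m)"
proof -
  obtain L where L: "length L = 2 * card (part_perms m)" "\<forall>r\<in>set L. linear_order_on (verts m) r"
    and count: "\<And>e f. e \<in> edges (complete_tripartite (m + 1) m m) \<Longrightarrow> f \<in> edges (complete_tripartite (m + 1) m m) \<Longrightarrow>
      nonincident e f \<Longrightarrow> card (part_perms m) * (2 * m + 1) \<le> 3 * m * length (filter (\<lambda>r. separates r e f) L)"
    using ex_base_list[OF m] by blast
  let ?L = "concat (replicate (n * (3 * m)) L)"
  have "length ?L = n * (3 * m) * length L"
    using length_filter_concat_replicate[of "\<lambda>_. True" "n * (3 * m)" L] by simp
  then have "length ?L = n * card (part_perms m) * (6 * m)" by (simp add: L(1))
  moreover have "separating_list (complete_tripartite (m + 1) m m) (n * card (part_perms m) * (2 * m + 1)) ?L"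
    unfolding separating_list_iff_filter vertices_tripartite length_filter_concat_replicate
  proof (intro conjI ballI impI)
    fix r assume "r \<in> set ?L"
    then show "linear_order_on (verts m) r" using L(2) by auto
  next
    fix e f assume "e \<in> edges (complete_tripartite (m + 1) m m)" "f \<in> edges (complete_tripartite (m + 1) m m)" "nonincident e f"
    from mult_le_mono2[OF count[OF this], of n]
    show "n * card (part_perms m) * (2 * m + 1) \<le> n * (3 * m) * length (filter (\<lambda>r. separates r e f) L)"
      by (simp only: mult.assoc)
  qed
  ultimately show ?thesis by blast
qed

theorem mainTheorem12:
  fixes m :: nat
  assumes "m \<ge> 2"
  shows "frac_sep_dim (complete_tripartite (m + 1) m m) = ereal (6 * real m / (2 * real m + 1))"
proof -
  let ?G = "complete_tripartite (m + 1) m m"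
  let ?f = "\<lambda>t. ereal (real (sep_dim t ?G) / real t)"
  let ?x = "6 * real m / (2 * real m + 1)"
  define c where "c = card (part_perms m)"
  have m: "m \<ge> 1" using assms by simp
  have c: "c > 0" unfolding c_def card_gt_0_iff using id_part_perms[of m] by auto
  have lists: "\<exists>L. separating_list ?G (n * c * (2 * m + 1)) L \<and> length L = n * c * (6 * m)" for n
    unfolding c_def by (rule ex_separating_list[OF m])
  show ?thesis unfolding frac_sep_dim_def
  proof (rule antisym)
    \<comment> \<open>Upper bound along the multiples of \<open>c * (2 * m + 1)\<close>, where
      explicit lists exist; a subsequence suffices for the limit inferior. \<open>Suc\<close> keeps
      the index positive, so the quotient is meaningful.\<close>
    let ?r = "\<lambda>n. Suc n * (c * (2 * m + 1))"
    have r: "strict_mono ?r" using c by (intro strict_monoI mult_strict_right_mono) auto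
    have "liminf ?f \<le> liminf (?f \<circ> ?r)" by (rule liminf_subseq_mono[OF r])
    also have "\<dots> \<le> liminf (\<lambda>n. ereal ?x)"
    proof (intro Liminf_mono always_eventually allI)
      fix n
      obtain L where L: "separating_list ?G (Suc n * c * (2 * m + 1)) L" "length L = Suc n * c * (6 * m)"
        using lists by blast
      have "sep_dim (Suc n * c * (2 * m + 1)) ?G \<le> Suc n * c * (6 * m)"
        unfolding sep_dim_def by (rule Least_le) (use L in blast)
      then have "real (sep_dim (Suc n * c * (2 * m + 1)) ?G) \<le> real (Suc n * c * (6 * m))"
        by (simp only: of_nat_le_iff)
      then have "real (sep_dim (Suc n * c * (2 * m + 1)) ?G) / real (Suc n * c * (2 * m + 1))
          \<le> real (Suc n * c * (6 * m)) / real (Suc n * c * (2 * m + 1))"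
        by (rule divide_right_mono) simp
      also have "\<dots> = (real (Suc n * c) * (6 * real m)) / (real (Suc n * c) * (2 * real m + 1))"
        by (simp only: of_nat_mult of_nat_add of_nat_numeral of_nat_1)
      also have "\<dots> = ?x"
      proof (rule mult_divide_mult_cancel_left)
        have "Suc n * c \<noteq> 0" using c by simp
        then show "real (Suc n * c) \<noteq> 0" by (simp only: of_nat_eq_0_iff not_False_eq_True)
      qed
      finally show "(?f \<circ> ?r) n \<le> ereal ?x" by (simp only: comp_def mult.assoc ereal_less_eq)
    qed
    also have "\<dots> = ereal ?x" by (rule Liminf_const) simp
    finally show "liminf ?f \<le> ereal ?x" .
  next
    show "ereal ?x \<le> liminf ?f"
    proof (rule Liminf_bounded, rule eventually_sequentiallyI[of 1])
      fix t :: nat assume t: "1 \<le> t"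
      obtain L where L: "separating_list ?G (t * c * (2 * m + 1)) L" using lists by blast
      \<comment> \<open>A list for a multiple of \<open>t\<close> also serves \<open>t\<close>, so
        some separating list exists and the minimum in \<open>sep_dim\<close> is attained. The
        length bound then applies to a shortest list.\<close>
      have "t * 1 \<le> t * (c * (2 * m + 1))" using c by (intro mult_le_mono2) simp
      then have "separating_list ?G t L" by (intro separating_list_mono[OF L]) (simp only: mult.assoc mult_1_right)
      then have "\<exists>k L. length L = k \<and> separating_list ?G t L" by blast
      from LeastI_ex[OF this] obtain L where L: "length L = sep_dim t ?G" "separating_list ?G t L"
        unfolding sep_dim_def by blast
      have "6 * real m * real t \<le> (2 * real m + 1) * real (sep_dim t ?G)"
        using separating_list_length_ge[OF m L(2)] by (simp only: L(1))
      then have "?x \<le> real (sep_dim t ?G) / real t"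
        using t by (simp add: divide_le_eq le_divide_eq mult.commute)
      then show "ereal ?x \<le> ?f t" by (simp only: ereal_less_eq)
    qed
  qed
qed

end
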